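(* There is a countable linear ordering with Scott sentence complexity $\Sigma^{\mathrm{in}}_4$.
   Context: Infinitary formulas: $\Sigma^{\mathrm{in}}_0=\Pi^{\mathrm{in}}_0$ are the finitary quantifier-free formulas; for $\alpha\ge1$, a $\Sigma^{\mathrm{in}}_\alpha$ formula is a countable disjunction of formulas $\exists\bar x\,\varphi$ with $\varphi\in\Pi^{\mathrm{in}}_\beta$, $\beta<\alpha$, and $\Pi^{\mathrm{in}}_\alpha$ is dual; $d\text{-}\Sigma^{\mathrm{in}}_\alpha$ formulas are conjunctions of a $\Sigma^{\mathrm{in}}_\alpha$ and a $\Pi^{\mathrm{in}}_\alpha$ formula. A Scott sentence of a countable structure is an $L_{\omega_1\omega}$ sentence whose countable models are exactly its isomorphic copies. The Scott sentence complexity of a structure is the least class among $\Pi^{\mathrm{in}}_\alpha,\Sigma^{\mathrm{in}}_\alpha,d\text{-}\Sigma^{\mathrm{in}}_\alpha$ ($\alpha\ge1$) in which it has a Scott sentence, classes ordered by inclusion up to equivalence ($\Pi_\alpha,\Sigma_\alpha\subseteq d\text{-}\Sigma_\alpha\subseteq \Sigma_{\alpha+1}\cap\Pi_{\alpha+1}$). *)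

theory Defs
  imports Main "HOL-Library.Countable_Set_Type"
begin

unbundle cardinal_syntax

text \<open>
  Formulas of \<open>L\<^bsub>\<omega>1\<omega>\<^esub>\<close> in the language of linear orders, which has equality and one binary
  relation symbol (\<open>LeF\<close>); variables are natural numbers.  Countable conjunctions and disjunctions
  range over countable sets of formulas, the empty and the finite ones included.
\<close>

datatype fm =
    EqF nat nat
  | LeF nat nat
  | NegF fm
  | ConjF "fm cset"
  | DisjF "fm cset"
  | ExF nat fm
  | AllF nat fm

primrec fv :: "fm \<Rightarrow> nat set" where
  "fv (EqF x y) = {x, y}"
| "fv (LeF x y) = {x, y}"
| "fv (NegF \<phi>) = fv \<phi>"
| "fv (ConjF \<Phi>) = \<Union> (rcset (cimage fv \<Phi>))"
| "fv (DisjF \<Phi>) = \<Union> (rcset (cimage fv \<Phi>))"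
| "fv (ExF x \<phi>) = fv \<phi> - {x}"
| "fv (AllF x \<phi>) = fv \<phi> - {x}"

definition sentence :: "fm \<Rightarrow> bool" where
  "sentence \<phi> \<longleftrightarrow> fv \<phi> = {}"

text \<open>
  A structure is a nonempty universe with a binary relation on it.  Every countable (finite or
  infinite) structure has an isomorphic copy whose universe is a set of natural numbers, so
  quantifying over the type below is quantifying over all countable structures up to isomorphism.
\<close>

type_synonym struct = "nat set \<times> nat rel"

definition is_struct :: "struct \<Rightarrow> bool" where
  "is_struct M \<longleftrightarrow> fst M \<noteq> {} \<and> snd M \<subseteq> fst M \<times> fst M"

definition isomorphic :: "struct \<Rightarrow> struct \<Rightarrow> bool" where
  "isomorphic M N \<longleftrightarrow> (\<exists>f. bij_betw f (fst M) (fst N) \<and>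
     (\<forall>x\<in>fst M. \<forall>y\<in>fst M. (x, y) \<in> snd M \<longleftrightarrow> (f x, f y) \<in> snd N))"

primrec sat :: "fm \<Rightarrow> struct \<Rightarrow> (nat \<Rightarrow> nat) \<Rightarrow> bool" where
  "sat (EqF x y) = (\<lambda>M e. e x = e y)"
| "sat (LeF x y) = (\<lambda>M e. (e x, e y) \<in> snd M)"
| "sat (NegF \<phi>) = (\<lambda>M e. \<not> sat \<phi> M e)"
| "sat (ConjF \<Phi>) = (\<lambda>M e. \<forall>s\<in>rcset (cimage sat \<Phi>). s M e)"
| "sat (DisjF \<Phi>) = (\<lambda>M e. \<exists>s\<in>rcset (cimage sat \<Phi>). s M e)"
| "sat (ExF x \<phi>) = (\<lambda>M e. \<exists>a\<in>fst M. sat \<phi> M (e(x := a)))"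
| "sat (AllF x \<phi>) = (\<lambda>M e. \<forall>a\<in>fst M. sat \<phi> M (e(x := a)))"

definition models :: "struct \<Rightarrow> fm \<Rightarrow> bool" where
  "models M \<phi> \<longleftrightarrow> (\<forall>e. range e \<subseteq> fst M \<longrightarrow> sat \<phi> M e)"

definition equivalent :: "fm \<Rightarrow> fm \<Rightarrow> bool" where
  "equivalent \<phi> \<psi> \<longleftrightarrow>
     (\<forall>M e. is_struct M \<longrightarrow> range e \<subseteq> fst M \<longrightarrow> (sat \<phi> M e \<longleftrightarrow> sat \<psi> M e))"

inductive qf :: "fm \<Rightarrow> bool" where
  "qf (EqF x y)"
| "qf (LeF x y)"
| "qf \<phi> \<Longrightarrow> qf (NegF \<phi>)"
| "finite (rcset \<Phi>) \<Longrightarrow> (\<And>\<phi>. \<phi> \<in> rcset \<Phi> \<Longrightarrow> qf \<phi>) \<Longrightarrow> qf (ConjF \<Phi>)"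
| "finite (rcset \<Phi>) \<Longrightarrow> (\<And>\<phi>. \<phi> \<in> rcset \<Phi> \<Longrightarrow> qf \<phi>) \<Longrightarrow> qf (DisjF \<Phi>)"

text \<open>
  The index \<open>\<alpha>\<close> is a countable ordinal, represented by a well-order on a set of natural numbers and
  compared by \<open><o\<close>; zero is the empty well-order.  The list \<open>xs\<close> is a finite, possibly empty, tuple
  of quantified variables.
\<close>

inductive is_Sigma :: "nat rel \<Rightarrow> fm \<Rightarrow> bool" and is_Pi :: "nat rel \<Rightarrow> fm \<Rightarrow> bool" where
  "qf \<phi> \<Longrightarrow> is_Sigma {} \<phi>"
| "qf \<phi> \<Longrightarrow> is_Pi {} \<phi>"
| "\<alpha> \<noteq> {} \<Longrightarrow>
   (\<And>\<psi>. \<psi> \<in> rcset \<Psi> \<Longrightarrow> \<exists>\<beta> xs \<phi>. \<beta> <o \<alpha> \<and> is_Pi \<beta> \<phi> \<and> \<psi> = foldr ExF xs \<phi>) \<Longrightarrow>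
   is_Sigma \<alpha> (DisjF \<Psi>)"
| "\<alpha> \<noteq> {} \<Longrightarrow>
   (\<And>\<psi>. \<psi> \<in> rcset \<Psi> \<Longrightarrow> \<exists>\<beta> xs \<phi>. \<beta> <o \<alpha> \<and> is_Sigma \<beta> \<phi> \<and> \<psi> = foldr AllF xs \<phi>) \<Longrightarrow>
   is_Pi \<alpha> (ConjF \<Psi>)"

text \<open>
  Formulas have finitely many free variables.  As quantifier blocks are finite, it suffices to ask
  this of the whole formula: it is then inherited by all subformulas.
\<close>

definition Sigma_in :: "nat rel \<Rightarrow> fm set" where
  "Sigma_in \<alpha> = {\<phi>. is_Sigma \<alpha> \<phi> \<and> finite (fv \<phi>)}"

definition Pi_in :: "nat rel \<Rightarrow> fm set" where
  "Pi_in \<alpha> = {\<phi>. is_Pi \<alpha> \<phi> \<and> finite (fv \<phi>)}"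

definition dSigma_in :: "nat rel \<Rightarrow> fm set" where
  "dSigma_in \<alpha> = {ConjF (cinsert \<sigma> (csingle \<pi>)) | \<sigma> \<pi>. \<sigma> \<in> Sigma_in \<alpha> \<and> \<pi> \<in> Pi_in \<alpha>}"

definition complexity_classes :: "fm set set" where
  "complexity_classes =
     (\<Union>\<alpha>\<in>{\<alpha>. Well_order \<alpha> \<and> \<alpha> \<noteq> {}}. {Pi_in \<alpha>, Sigma_in \<alpha>, dSigma_in \<alpha>})"

definition class_le :: "fm set \<Rightarrow> fm set \<Rightarrow> bool" where
  "class_le \<Gamma> \<Delta> \<longleftrightarrow> (\<forall>\<phi>\<in>\<Gamma>. \<exists>\<psi>\<in>\<Delta>. equivalent \<phi> \<psi>)"

definition scott_sentence :: "struct \<Rightarrow> fm \<Rightarrow> bool" where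
  "scott_sentence M \<phi> \<longleftrightarrow>
     sentence \<phi> \<and> (\<forall>N. is_struct N \<longrightarrow> (models N \<phi> \<longleftrightarrow> isomorphic M N))"

definition has_scott_sentence_in :: "struct \<Rightarrow> fm set \<Rightarrow> bool" where
  "has_scott_sentence_in M \<Gamma> \<longleftrightarrow> (\<exists>\<phi>\<in>\<Gamma>. scott_sentence M \<phi>)"

text \<open>
  This is a predicate rather than a function because a least class is unique only up to
  equivalence of formulas.
\<close>

definition scott_sentence_complexity :: "struct \<Rightarrow> fm set \<Rightarrow> bool" where
  "scott_sentence_complexity M \<Gamma> \<longleftrightarrow>
     \<Gamma> \<in> complexity_classes \<and> has_scott_sentence_in M \<Gamma> \<and>
     (\<forall>\<Delta>\<in>complexity_classes. has_scott_sentence_in M \<Delta> \<longrightarrow> class_le \<Gamma> \<Delta>)"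

end

theory Submission
  imports Defs
begin

text \<open>
  The order is \<open>\<omega> + 1 + \<eta>\<close>.  Over the middle point it splits into \<open>\<omega>\<close> and \<open>\<eta>\<close>, which have Scott
  sentences \<open>\<Pi>\<^sub>3\<close> and \<open>\<Pi>\<^sub>2\<close>, so quantifying the middle point existentially gives a \<open>\<Sigma>\<^sub>4\<close> Scott
  sentence.  There is no \<open>\<Pi>\<^sub>4\<close> Scott sentence because every \<open>\<Pi>\<^sub>4\<close> sentence true in \<open>\<omega> + 1 + \<eta>\<close> holds in
  \<open>\<omega> + \<eta>\<close>: all that a \<open>\<Pi>\<^sub>2\<close> sentence can say about \<open>\<omega>\<close> is that it has no last element, so a
  \<open>\<Sigma>\<^sub>3\<close> formula cannot tell the middle point from a small element of \<open>\<eta>\<close>.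
\<close>

section \<open>Satisfaction\<close>

text \<open>Excluding \<open>\<Pi>\<^sub>4\<close> is nearly all that minimality asks. From index 4
  on, every class contains \<open>\<Sigma>\<^sub>4\<close> up to equivalence, with the exception of
  \<open>\<Pi>\<^sub>4\<close>. Below index 4 the same two orders serve, because the transfer of
  rank 3 in the opposite direction carries \<open>\<Sigma>\<^sub>3\<close> sentences the same way.
  Both orders live in the rationals and differ in the single point 0, so a tuple of the smaller
  order can answer itself. The obstacle is a challenge that names 0. Its stand-in is a positive q
  below all other positive points named; a later challenge may then name points between \<omega> and
  q, although nothing lies between \<omega> and 0. Pulling them down into \<omega> is good for one
  more move only, after which just the order of finitely many points is compared. This chain of
  moves accounts for the number 4. Valuations are total, so a finite tuple appears as a valuation of
  finite range, and a move changes it on finitely many variables.\<close>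

lemma sat_ConjF: "sat (ConjF \<Phi>) M e \<longleftrightarrow> (\<forall>\<phi>\<in>rcset \<Phi>. sat \<phi> M e)"
  by (simp add: cimage.rep_eq)

lemma sat_DisjF: "sat (DisjF \<Phi>) M e \<longleftrightarrow> (\<exists>\<phi>\<in>rcset \<Phi>. sat \<phi> M e)"
  by (simp add: cimage.rep_eq)

lemma fv_ConjF: "fv (ConjF \<Phi>) = (\<Union>\<phi>\<in>rcset \<Phi>. fv \<phi>)"
  by (simp add: cimage.rep_eq)

lemma fv_DisjF: "fv (DisjF \<Phi>) = (\<Union>\<phi>\<in>rcset \<Phi>. fv \<phi>)"
  by (simp add: cimage.rep_eq)

declare sat.simps(4,5)[simp del] fv.simps(4,5)[simp del]
declare sat_ConjF[simp] sat_DisjF[simp] fv_ConjF[simp] fv_DisjF[simp]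

lemma sat_cong_fv:
  assumes "\<And>x. x \<in> fv \<phi> \<Longrightarrow> e x = e' x"
  shows "sat \<phi> M e \<longleftrightarrow> sat \<phi> M e'"
  using assms
proof (induction \<phi> arbitrary: e e')
  case (ConjF \<Phi>)
  have "sat \<phi> M e \<longleftrightarrow> sat \<phi> M e'" if "\<phi> \<in> rcset \<Phi>" for \<phi>
    by (rule ConjF.IH[OF that]) (use ConjF.prems that in auto)
  then show ?case by simp
next
  case (DisjF \<Phi>)
  have "sat \<phi> M e \<longleftrightarrow> sat \<phi> M e'" if "\<phi> \<in> rcset \<Phi>" for \<phi>
    by (rule DisjF.IH[OF that]) (use DisjF.prems that in auto)
  then show ?case by simp
next
  case (ExF x \<phi>)
  have "sat \<phi> M (e(x := a)) \<longleftrightarrow> sat \<phi> M (e'(x := a))" for a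
    by (rule ExF.IH) (use ExF.prems in auto)
  then show ?case by simp
next
  case (AllF x \<phi>)
  have "sat \<phi> M (e(x := a)) \<longleftrightarrow> sat \<phi> M (e'(x := a))" for a
    by (rule AllF.IH) (use AllF.prems in auto)
  then show ?case by simp
next
  case (NegF \<phi>)
  have "sat \<phi> M e \<longleftrightarrow> sat \<phi> M e'"
    by (rule NegF.IH) (use NegF.prems in auto)
  then show ?case by simp
qed simp_all

lemma models_sentence_iff:
  assumes "sentence \<phi>" "range e \<subseteq> fst M"
  shows "models M \<phi> \<longleftrightarrow> sat \<phi> M e"
proof -
  have "sat \<phi> M e' \<longleftrightarrow> sat \<phi> M e" for e'
    by (rule sat_cong_fv) (use assms(1) in \<open>simp add: sentence_def\<close>)
  then show ?thesis using assms(2) unfolding models_def by blast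
qed

text \<open>Equality atoms rely on injectivity of f, which is known only on the universe; hence
  valuations must stay inside it, and the quantifier cases check this for the updated
  valuation.\<close>

lemma sat_isomorphism:
  assumes f: "bij_betw f (fst M) (fst N)"
    and R: "\<And>x y. x \<in> fst M \<Longrightarrow> y \<in> fst M \<Longrightarrow> (x, y) \<in> snd M \<longleftrightarrow> (f x, f y) \<in> snd N"
    and e: "range e \<subseteq> fst M"
  shows "sat \<phi> M e \<longleftrightarrow> sat \<phi> N (f \<circ> e)"
  using e
proof (induction \<phi> arbitrary: e)
  case (EqF x y)
  then have "f (e x) = f (e y) \<longleftrightarrow> e x = e y"
    using f by (intro inj_on_eq_iff[of f "fst M"]) (auto simp: bij_betw_def)
  then show ?case by simp
next
  case (LeF x y)
  then have "e x \<in> fst M" "e y \<in> fst M" by auto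
  then show ?case using R by simp
next
  case (ExF x \<phi>)
  have "sat \<phi> M (e(x := a)) \<longleftrightarrow> sat \<phi> N ((f \<circ> e)(x := f a))" if "a \<in> fst M" for a
  proof -
    have "range (e(x := a)) \<subseteq> fst M" using ExF.prems that by auto
    moreover have "f \<circ> e(x := a) = (f \<circ> e)(x := f a)" by auto
    ultimately show ?thesis using ExF.IH[of "e(x := a)"] by (simp only:)
  qed
  moreover have "fst N = f ` fst M" using f by (simp add: bij_betw_def)
  ultimately show ?case by (simp only: sat.simps ball_simps bex_simps cong: ball_cong bex_cong)
next
  case (AllF x \<phi>)
  have "sat \<phi> M (e(x := a)) \<longleftrightarrow> sat \<phi> N ((f \<circ> e)(x := f a))" if "a \<in> fst M" for a
  proof -
    have "range (e(x := a)) \<subseteq> fst M" using AllF.prems that by auto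
    moreover have "f \<circ> e(x := a) = (f \<circ> e)(x := f a)" by auto
    ultimately show ?thesis using AllF.IH[of "e(x := a)"] by (simp only:)
  qed
  moreover have "fst N = f ` fst M" using f by (simp add: bij_betw_def)
  ultimately show ?case by (simp only: sat.simps ball_simps bex_simps cong: ball_cong bex_cong)
next
  case (ConjF \<Phi>)
  have "sat \<phi> M e \<longleftrightarrow> sat \<phi> N (f \<circ> e)" if "\<phi> \<in> rcset \<Phi>" for \<phi>
    by (rule ConjF.IH[OF that ConjF.prems])
  then show ?case by (simp only: sat_ConjF cong: ball_cong)
next
  case (DisjF \<Phi>)
  have "sat \<phi> M e \<longleftrightarrow> sat \<phi> N (f \<circ> e)" if "\<phi> \<in> rcset \<Phi>" for \<phi>
    by (rule DisjF.IH[OF that DisjF.prems])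
  then show ?case by (simp only: sat_DisjF cong: bex_cong)
next
  case (NegF \<phi>)
  then show ?case by (simp only: sat.simps)
qed

lemma models_isomorphic:
  assumes "isomorphic M N" "sentence \<phi>" "fst M \<noteq> {}" "models M \<phi>"
  shows "models N \<phi>"
proof -
  obtain f where f: "bij_betw f (fst M) (fst N)"
    "\<And>x y. x \<in> fst M \<Longrightarrow> y \<in> fst M \<Longrightarrow> (x, y) \<in> snd M \<longleftrightarrow> (f x, f y) \<in> snd N"
    using assms(1) unfolding isomorphic_def by blast
  obtain a where a: "a \<in> fst M" using assms(3) by blast
  define e :: "nat \<Rightarrow> nat" where "e = (\<lambda>_. a)"
  have e: "range e \<subseteq> fst M" "range (f \<circ> e) \<subseteq> fst N"
    using a f(1) by (auto simp: e_def bij_betw_def)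
  have "sat \<phi> M e" using assms(2,4) e(1) models_sentence_iff by blast
  then have "sat \<phi> N (f \<circ> e)" using sat_isomorphism[OF f e(1)] by blast
  then show ?thesis using assms(2) e(2) models_sentence_iff by blast
qed

text \<open>The valuations reachable through one quantifier block. They depend on
  \<open>set xs\<close> alone, so the order and repetition of variables in a block disappear, and a
  block becomes a single move of the later game.\<close>

definition updates :: "struct \<Rightarrow> nat list \<Rightarrow> (nat \<Rightarrow> nat) \<Rightarrow> (nat \<Rightarrow> nat) set" where
  "updates M xs e = {e'. (\<forall>x\<in>set xs. e' x \<in> fst M) \<and> (\<forall>x. x \<notin> set xs \<longrightarrow> e' x = e x)}"

lemma updates_Nil [simp]: "updates M [] e = {e}"
  by (auto simp: updates_def)

lemma updates_Cons: "updates M (x # xs) e = (\<Union>a\<in>fst M. updates M xs (e(x := a)))"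
proof (intro equalityI subsetI)
  fix e' assume e': "e' \<in> updates M (x # xs) e"
  then have "e' \<in> updates M xs (e(x := e' x))" "e' x \<in> fst M" by (auto simp: updates_def)
  then show "e' \<in> (\<Union>a\<in>fst M. updates M xs (e(x := a)))" by blast
next
  fix e' assume "e' \<in> (\<Union>a\<in>fst M. updates M xs (e(x := a)))"
  then obtain a where "a \<in> fst M" "e' \<in> updates M xs (e(x := a))" by blast
  \<comment> \<open>If x occurs again in xs, the inner quantifier overwrites the value a.\<close>
  then show "e' \<in> updates M (x # xs) e"
    by (cases "x \<in> set xs") (auto simp: updates_def)
qed

lemma sat_foldr_ExF: "sat (foldr ExF xs \<phi>) M e \<longleftrightarrow> (\<exists>e'\<in>updates M xs e. sat \<phi> M e')"
  by (induction xs arbitrary: e) (auto simp: updates_Cons)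

lemma sat_foldr_AllF: "sat (foldr AllF xs \<phi>) M e \<longleftrightarrow> (\<forall>e'\<in>updates M xs e. sat \<phi> M e')"
  by (induction xs arbitrary: e) (auto simp: updates_Cons)

lemma fv_foldr_ExF [simp]: "fv (foldr ExF xs \<phi>) = fv \<phi> - set xs"
  by (induction xs) auto

section \<open>Partial isomorphisms of linear orders\<close>

text \<open>The relation may extend beyond A, so the segments of one structure are all ordered by
  the same \<open>snd M\<close>, without restricting it. The four clauses are matched one by one in
  \<open>middle_axioms\<close>.\<close>

definition lin_on :: "'a set \<Rightarrow> 'a rel \<Rightarrow> bool" where
  "lin_on A r \<longleftrightarrow> (\<forall>x\<in>A. (x, x) \<in> r) \<and> (\<forall>x\<in>A. \<forall>y\<in>A. (x, y) \<in> r \<longrightarrow> (y, x) \<in> r \<longrightarrow> x = y) \<and>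
     (\<forall>x\<in>A. \<forall>y\<in>A. \<forall>z\<in>A. (x, y) \<in> r \<longrightarrow> (y, z) \<in> r \<longrightarrow> (x, z) \<in> r) \<and>
     (\<forall>x\<in>A. \<forall>y\<in>A. (x, y) \<in> r \<or> (y, x) \<in> r)"

lemma lin_onD:
  assumes "lin_on A r"
  shows lin_on_refl: "x \<in> A \<Longrightarrow> (x, x) \<in> r"
    and lin_on_antisym: "(x, y) \<in> r \<Longrightarrow> (y, x) \<in> r \<Longrightarrow> x \<in> A \<Longrightarrow> y \<in> A \<Longrightarrow> x = y"
    and lin_on_trans: "(x, y) \<in> r \<Longrightarrow> (y, z) \<in> r \<Longrightarrow> x \<in> A \<Longrightarrow> y \<in> A \<Longrightarrow> z \<in> A \<Longrightarrow> (x, z) \<in> r"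
    and lin_on_total: "x \<in> A \<Longrightarrow> y \<in> A \<Longrightarrow> (x, y) \<in> r \<or> (y, x) \<in> r"
  using assms unfolding lin_on_def by blast+

lemma lin_on_subset: "lin_on A r \<Longrightarrow> B \<subseteq> A \<Longrightarrow> lin_on B r"
  unfolding lin_on_def by (meson subsetD)

lemma lin_on_converse: "lin_on A r \<Longrightarrow> lin_on A (r\<inverse>)"
  unfolding lin_on_def by blast

lemma lin_on_finite_least:
  assumes "lin_on A r" "finite F" "F \<noteq> {}" "F \<subseteq> A"
  shows "\<exists>m\<in>F. \<forall>x\<in>F. (m, x) \<in> r"
  using assms(2-4)
proof (induction rule: finite_ne_induct)
  case (singleton x)
  then show ?case using assms(1) by (auto simp: lin_on_def)
next
  case (insert x F)
  then obtain m where m: "m \<in> F" "\<forall>y\<in>F. (m, y) \<in> r" by auto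
  have mem: "x \<in> A" "m \<in> A" "F \<subseteq> A" using insert.prems m(1) by auto
  show ?case
  proof (cases "(m, x) \<in> r")
    case True
    then show ?thesis using m by blast
  next
    case False
    then have xm: "(x, m) \<in> r" using lin_on_total[OF assms(1)] mem by blast
    have "(x, y) \<in> r" if "y \<in> F" for y
      using lin_on_trans[OF assms(1) xm] m(2) that mem by blast
    then show ?thesis using lin_on_refl[OF assms(1) mem(1)] by blast
  qed
qed

section \<open>Dense orders without endpoints and Cantor's back-and-forth theorem\<close>

definition dlo_on :: "'a set \<Rightarrow> 'a rel \<Rightarrow> bool" where
  "dlo_on A r \<longleftrightarrow> lin_on A r \<and> A \<noteq> {} \<and>
     (\<forall>x\<in>A. \<exists>y\<in>A. (x, y) \<in> r \<and> x \<noteq> y) \<and> (\<forall>x\<in>A. \<exists>y\<in>A. (y, x) \<in> r \<and> x \<noteq> y) \<and>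
     (\<forall>x\<in>A. \<forall>y\<in>A. (x, y) \<in> r \<and> x \<noteq> y \<longrightarrow>
        (\<exists>z\<in>A. (x, z) \<in> r \<and> x \<noteq> z \<and> (z, y) \<in> r \<and> z \<noteq> y))"

text \<open>Only the greatest point of L and the least point of U matter. If one of them is missing,
  the absence of endpoints replaces density; if both are missing, any point of A will do.\<close>

lemma dlo_on_between_finite:
  assumes dlo: "dlo_on A r" and fin: "finite L" "finite U" and sub: "L \<subseteq> A" "U \<subseteq> A"
    and less: "\<And>l u. l \<in> L \<Longrightarrow> u \<in> U \<Longrightarrow> (l, u) \<in> r \<and> l \<noteq> u"
  shows "\<exists>y\<in>A. (\<forall>l\<in>L. (l, y) \<in> r \<and> l \<noteq> y) \<and> (\<forall>u\<in>U. (y, u) \<in> r \<and> y \<noteq> u)"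
proof -
  have lin: "lin_on A r" using dlo by (simp add: dlo_on_def)
  note lo = lin_on_trans[OF lin] lin_on_antisym[OF lin]
  have up: "\<exists>y\<in>A. (x, y) \<in> r \<and> x \<noteq> y" if "x \<in> A" for x
    using dlo that by (simp add: dlo_on_def)
  have down: "\<exists>y\<in>A. (y, x) \<in> r \<and> y \<noteq> x" if "x \<in> A" for x
    using dlo that by (simp add: dlo_on_def) metis
  have betw: "\<exists>z\<in>A. (x, z) \<in> r \<and> x \<noteq> z \<and> (z, y) \<in> r \<and> z \<noteq> y"
    if "(x, y) \<in> r" "x \<noteq> y" "x \<in> A" "y \<in> A" for x y
    using dlo that by (simp add: dlo_on_def)
  have below: "(l, y) \<in> r \<and> l \<noteq> y"
    if "l \<in> A" "m \<in> A" "y \<in> A" "(l, m) \<in> r" "(m, y) \<in> r" "m \<noteq> y" for l m y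
    using that lo by blast
  have above: "(y, u) \<in> r \<and> y \<noteq> u"
    if "u \<in> A" "m \<in> A" "y \<in> A" "(m, u) \<in> r" "(y, m) \<in> r" "y \<noteq> m" for u m y
    using that lo by blast
  have max: "\<exists>m\<in>L. \<forall>l\<in>L. (l, m) \<in> r" if "L \<noteq> {}"
    using lin_on_finite_least[OF lin_on_converse[OF lin] fin(1) that sub(1)] by auto
  have min: "\<exists>m\<in>U. \<forall>u\<in>U. (m, u) \<in> r" if "U \<noteq> {}"
    using lin_on_finite_least[OF lin fin(2) that sub(2)] .
  consider "L = {}" "U = {}" | "L \<noteq> {}" "U = {}" | "L = {}" "U \<noteq> {}" | "L \<noteq> {}" "U \<noteq> {}"
    by blast
  then show ?thesis
  proof cases
    case 1
    then show ?thesis using dlo by (auto simp: dlo_on_def)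
  next
    case 2
    then obtain m where m: "m \<in> L" "\<forall>l\<in>L. (l, m) \<in> r" using max by blast
    obtain y where y: "y \<in> A" "(m, y) \<in> r" "m \<noteq> y"
      using up m(1) sub(1) by blast
    have "(l, y) \<in> r \<and> l \<noteq> y" if "l \<in> L" for l
      by (rule below[of l m y]) (use m y that sub in auto)
    then show ?thesis using 2 y(1) by blast
  next
    case 3
    then obtain m where m: "m \<in> U" "\<forall>u\<in>U. (m, u) \<in> r" using min by blast
    obtain y where y: "y \<in> A" "(y, m) \<in> r" "y \<noteq> m"
      using down m(1) sub(2) by blast
    have "(y, u) \<in> r \<and> y \<noteq> u" if "u \<in> U" for u
      by (rule above[of u m y]) (use m y that sub in auto)
    then show ?thesis using 3 y(1) by blast
  next
    case 4
    then obtain m k where m: "m \<in> L" "\<forall>l\<in>L. (l, m) \<in> r" and k: "k \<in> U" "\<forall>u\<in>U. (k, u) \<in> r"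
      using max min by blast
    have "(m, k) \<in> r" "m \<noteq> k" "m \<in> A" "k \<in> A" using less m(1) k(1) sub by auto
    then obtain y where y: "y \<in> A" "(m, y) \<in> r" "m \<noteq> y" "(y, k) \<in> r" "y \<noteq> k"
      using betw by blast
    have "(l, y) \<in> r \<and> l \<noteq> y" if "l \<in> L" for l
      by (rule below[of l m y]) (use m y that sub in auto)
    moreover have "(y, u) \<in> r \<and> y \<noteq> u" if "u \<in> U" for u
      by (rule above[of u k y]) (use k y that sub in auto)
    ultimately show ?thesis using y(1) by blast
  qed
qed

text \<open>Graphs rather than functions: the converse of a partial isomorphism is again one, which
  yields the back step from the forth step, while antisymmetry of the linear orders makes the graph
  single-valued and injective.\<close>

definition partial_iso :: "'a set \<Rightarrow> 'a rel \<Rightarrow> 'b set \<Rightarrow> 'b rel \<Rightarrow> ('a \<times> 'b) set \<Rightarrow> bool" where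
  "partial_iso A r B s p \<longleftrightarrow> p \<subseteq> A \<times> B \<and>
     (\<forall>(x, y)\<in>p. \<forall>(x', y')\<in>p. (x, x') \<in> r \<longleftrightarrow> (y, y') \<in> s)"

lemma partial_isoI:
  assumes "p \<subseteq> A \<times> B"
    and "\<And>x y x' y'. (x, y) \<in> p \<Longrightarrow> (x', y') \<in> p \<Longrightarrow> (x, x') \<in> r \<longleftrightarrow> (y, y') \<in> s"
  shows "partial_iso A r B s p"
  using assms unfolding partial_iso_def by auto

lemma partial_isoD:
  assumes "partial_iso A r B s p" "(x, y) \<in> p"
  shows "x \<in> A" "y \<in> B" "(x', y') \<in> p \<Longrightarrow> (x, x') \<in> r \<longleftrightarrow> (y, y') \<in> s"
  using assms unfolding partial_iso_def by auto

lemma partial_iso_converse: "partial_iso A r B s p \<Longrightarrow> partial_iso B s A r (p\<inverse>)"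
  unfolding partial_iso_def by fast

lemma partial_iso_single_valued:
  assumes "partial_iso A r B s p" "lin_on A r" "lin_on B s" "(x, y) \<in> p" "(x, y') \<in> p"
  shows "y = y'"
proof -
  have "(x, x) \<in> r" using partial_isoD(1)[OF assms(1,4)] lin_on_refl[OF assms(2)] by blast
  then have "(y, y') \<in> s" "(y', y) \<in> s"
    using partial_isoD(3)[OF assms(1)] assms(4,5) by blast+
  then show ?thesis
    using lin_on_antisym[OF assms(3)] partial_isoD(2)[OF assms(1)] assms(4,5) by blast
qed

text \<open>The images of the points below x and of those above x form a finite cut in B, which
  density fills. The two sides are treated differently because \<open>transfers_1\<close> maps a ray
  with a least point into the positive rationals.\<close>

lemma partial_iso_extend:
  assumes p: "partial_iso A r B s p" "finite p" and lin: "lin_on A r" and dlo: "dlo_on B s"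
    and x: "x \<in> A"
  shows "\<exists>y. partial_iso A r B s (insert (x, y) p)"
proof (cases "x \<in> Domain p")
  case True
  then show ?thesis using p(1) by (metis DomainE insert_absorb)
next
  case False
  have linB: "lin_on B s" using dlo by (simp add: dlo_on_def)
  define L where "L = {y. \<exists>x'. (x', y) \<in> p \<and> (x', x) \<in> r}"
  define U where "U = {y. \<exists>x'. (x', y) \<in> p \<and> (x, x') \<in> r}"
  have "L \<subseteq> Range p" "U \<subseteq> Range p" by (auto simp: L_def U_def)
  moreover have "finite (Range p)" using p(2) by (rule finite_Range)
  ultimately have fin: "finite L" "finite U" by (auto intro: finite_subset)
  have sub: "L \<subseteq> B" "U \<subseteq> B" using partial_isoD(2)[OF p(1)] by (auto simp: L_def U_def)
  have less: "(l, u) \<in> s \<and> l \<noteq> u" if lu: "l \<in> L" "u \<in> U" for l u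
  proof -
    obtain a b where a: "(a, l) \<in> p" "(a, x) \<in> r" and b: "(b, u) \<in> p" "(x, b) \<in> r"
      using lu by (auto simp: L_def U_def)
    have mem: "a \<in> A" "b \<in> A" using a(1) b(1) partial_isoD(1)[OF p(1)] by auto
    then have "(a, b) \<in> r" using lin_on_trans[OF lin a(2) b(2)] x by blast
    moreover have "a \<noteq> b"
      using lin_on_antisym[OF lin a(2)] a(1) b(2) mem x False by (metis Domain.DomainI)
    moreover have "(a, b) \<in> r \<longleftrightarrow> (l, u) \<in> s" "(b, a) \<in> r \<longleftrightarrow> (u, l) \<in> s"
      using partial_isoD(3)[OF p(1)] a(1) b(1) by blast+
    ultimately show ?thesis
      using lin_on_antisym[OF lin] mem by metis
  qed
  obtain y where y: "y \<in> B" "\<forall>l\<in>L. (l, y) \<in> s \<and> l \<noteq> y" "\<forall>u\<in>U. (y, u) \<in> s \<and> y \<noteq> u"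
    using dlo_on_between_finite[OF dlo fin sub less] by blast
  have "((x, a) \<in> r \<longleftrightarrow> (y, b) \<in> s) \<and> ((a, x) \<in> r \<longleftrightarrow> (b, y) \<in> s)" if ab: "(a, b) \<in> p" for a b
  proof -
    have mem: "a \<in> A" "b \<in> B" using partial_isoD[OF p(1) ab] by auto
    have "a \<noteq> x" using ab False by blast
    then consider "(x, a) \<in> r" "(a, x) \<notin> r" | "(a, x) \<in> r" "(x, a) \<notin> r"
      using lin_on_total[OF lin x mem(1)] lin_on_antisym[OF lin] x mem(1) by blast
    then show ?thesis
    proof cases
      case 1
      then have "b \<in> U" using ab by (auto simp: U_def)
      then show ?thesis using 1 y lin_on_antisym[OF linB] mem(2) by blast
    next
      case 2
      then have "b \<in> L" using ab by (auto simp: L_def)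
      then show ?thesis using 2 y lin_on_antisym[OF linB] mem(2) by blast
    qed
  qed
  moreover have "(x, x) \<in> r" "(y, y) \<in> s" using lin_on_refl[OF lin x] lin_on_refl[OF linB y(1)] by auto
  ultimately have "partial_iso A r B s (insert (x, y) p)"
    using p(1) x y(1) unfolding partial_iso_def by auto
  then show ?thesis by blast
qed

lemma partial_iso_extend_finite:
  assumes "partial_iso A r B s p" "finite p" "lin_on A r" "dlo_on B s" "finite Z" "Z \<subseteq> A"
  shows "\<exists>q. p \<subseteq> q \<and> partial_iso A r B s q \<and> finite q \<and> Z \<subseteq> Domain q"
  using assms(5,6)
proof (induction rule: finite_induct)
  case empty
  then show ?case using assms by auto
next
  case (insert x Z)
  then obtain q where q: "p \<subseteq> q" "partial_iso A r B s q" "finite q" "Z \<subseteq> Domain q" by auto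
  obtain y where "partial_iso A r B s (insert (x, y) q)"
    using partial_iso_extend[OF q(2,3) assms(3,4)] insert.prems by blast
  then show ?case using q by (intro exI[of _ "insert (x, y) q"]) auto
qed

definition iso_graph :: "'a set \<Rightarrow> 'a rel \<Rightarrow> 'b set \<Rightarrow> 'b rel \<Rightarrow> ('a \<times> 'b) set \<Rightarrow> bool" where
  "iso_graph A r B s p \<longleftrightarrow> partial_iso A r B s p \<and> Domain p = A \<and> Range p = B"

text \<open>Cantor's theorem: a chain of finite partial isomorphisms, whose stage n takes care of
  the n-th point of either side, has an isomorphism as its union.\<close>

lemma dlo_on_iso_graph:
  fixes A :: "'a :: countable set" and B :: "'b :: countable set"
  assumes A: "dlo_on A r" and B: "dlo_on B s"
  shows "\<exists>p. iso_graph A r B s p"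
proof -
  have lin: "lin_on A r" "lin_on B s" using assms by (auto simp: dlo_on_def)
  define good where "good p \<longleftrightarrow> partial_iso A r B s p \<and> finite p" for p
  \<comment> \<open>Since \<open>from_nat n\<close> need not lie in A or B, the singleton is
    intersected with them and the demand may be void. The back half is the forth half applied to the
    converse graph.\<close>
  have step: "\<exists>q. good q \<and> p \<subseteq> q \<and> ({from_nat n} \<inter> A \<subseteq> Domain q) \<and> ({from_nat n} \<inter> B \<subseteq> Range q)"
    if p: "good p" for p and n :: nat
  proof -
    obtain q where q: "p \<subseteq> q" "partial_iso A r B s q" "finite q" "{from_nat n} \<inter> A \<subseteq> Domain q"
      using partial_iso_extend_finite[OF _ _ lin(1) B, of p "{from_nat n} \<inter> A"] p
      unfolding good_def by auto
    obtain q' where q': "q\<inverse> \<subseteq> q'" "partial_iso B s A r q'" "finite q'" "{from_nat n} \<inter> B \<subseteq> Domain q'"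
      using partial_iso_extend_finite[OF partial_iso_converse[OF q(2)] _ lin(2) A, of "{from_nat n} \<inter> B"] q(3)
      by auto
    have "q \<subseteq> q'\<inverse>" using q'(1) by auto
    then have "good (q'\<inverse>)" "p \<subseteq> q'\<inverse>" "{from_nat n} \<inter> A \<subseteq> Domain (q'\<inverse>)"
      "{from_nat n} \<inter> B \<subseteq> Range (q'\<inverse>)"
      using q q'(3,4) partial_iso_converse[OF q'(2)] Domain_mono[of q "q'\<inverse>"]
      unfolding good_def by auto
    then show ?thesis by blast
  qed
  have "good {}" by (simp add: good_def partial_iso_def)
  then obtain P where "\<forall>n. good (P n) \<and> P n \<subseteq> P (Suc n) \<and>
      {from_nat n} \<inter> A \<subseteq> Domain (P (Suc n)) \<and> {from_nat n} \<inter> B \<subseteq> Range (P (Suc n))"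
    using dependent_nat_choice[of "\<lambda>_. good" "\<lambda>n p q. p \<subseteq> q \<and>
      ({from_nat n} \<inter> A \<subseteq> Domain q) \<and> ({from_nat n} \<inter> B \<subseteq> Range q)"] step
    by blast
  then have P: "\<And>n. good (P n)" "\<And>n. P n \<subseteq> P (Suc n)"
    "\<And>n. {from_nat n} \<inter> A \<subseteq> Domain (P (Suc n))" "\<And>n. {from_nat n} \<inter> B \<subseteq> Range (P (Suc n))"
    by auto
  have mono: "P m \<subseteq> P n" if "m \<le> n" for m n
    using lift_Suc_mono_le[of P] P(2) that by blast
  define p where "p = (\<Union>n. P n)"
  have "(x, x') \<in> r \<longleftrightarrow> (y, y') \<in> s" if "(x, y) \<in> p" "(x', y') \<in> p" for x y x' y'
  proof -
    obtain m n where "(x, y) \<in> P m" "(x', y') \<in> P n" using \<open>(x, y) \<in> p\<close> \<open>(x', y') \<in> p\<close> by (auto simp: p_def)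
    then have mem: "(x, y) \<in> P (max m n)" "(x', y') \<in> P (max m n)"
      using mono[of m "max m n"] mono[of n "max m n"] by auto
    have "partial_iso A r B s (P (max m n))" using P(1) by (simp add: good_def)
    then show ?thesis using mem by (rule partial_isoD(3))
  qed
  moreover have "p \<subseteq> A \<times> B" using P(1) by (auto simp: p_def good_def partial_iso_def)
  moreover have "A \<subseteq> Domain p"
  proof
    fix x assume "x \<in> A"
    then have "x \<in> Domain (P (Suc (to_nat x)))" using P(3)[of "to_nat x"] by simp
    then show "x \<in> Domain p" unfolding p_def by blast
  qed
  moreover have "B \<subseteq> Range p"
  proof
    fix x assume "x \<in> B"
    then have "x \<in> Range (P (Suc (to_nat x)))" using P(4)[of "to_nat x"] by simp
    then show "x \<in> Range p" unfolding p_def by blast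
  qed
  ultimately have "iso_graph A r B s p" by (auto simp: iso_graph_def partial_iso_def)
  then show ?thesis by blast
qed

text \<open>Isomorphisms between the summands of ordered sums glue: a mixed pair is decided on both
  sides by the position of the summands. This is applied twice, to join \<omega>, the middle point
  and \<eta>.\<close>

lemma iso_graph_Un:
  assumes p: "iso_graph A r B s p" and q: "iso_graph C r D s q"
    and "\<And>x y. x \<in> A \<Longrightarrow> y \<in> C \<Longrightarrow> (x, y) \<in> r \<and> (y, x) \<notin> r"
    and "\<And>x y. x \<in> B \<Longrightarrow> y \<in> D \<Longrightarrow> (x, y) \<in> s \<and> (y, x) \<notin> s"
  shows "iso_graph (A \<union> C) r (B \<union> D) s (p \<union> q)"
proof -
  note p' = p[unfolded iso_graph_def] and q' = q[unfolded iso_graph_def]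
  have "(x, x') \<in> r \<longleftrightarrow> (y, y') \<in> s"
    if mem: "(x, y) \<in> p \<union> q" "(x', y') \<in> p \<union> q" for x y x' y'
  proof -
    consider "(x, y) \<in> p" "(x', y') \<in> p" | "(x, y) \<in> q" "(x', y') \<in> q" |
      "(x, y) \<in> p" "(x', y') \<in> q" | "(x, y) \<in> q" "(x', y') \<in> p"
      using mem by blast
    then show ?thesis
    proof cases
      case 1
      then show ?thesis using partial_isoD(3)[of A r B s p] p' by simp
    next
      case 2
      then show ?thesis using partial_isoD(3)[of C r D s q] q' by simp
    next
      case 3
      then have "x \<in> A" "y \<in> B" "x' \<in> C" "y' \<in> D" using p' q' by auto
      then show ?thesis using assms(3,4) by simp
    next
      case 4
      then have "x \<in> C" "y \<in> D" "x' \<in> A" "y' \<in> B" using p' q' by auto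
      then show ?thesis using assms(3,4) by simp
    qed
  qed
  moreover have "p \<union> q \<subseteq> (A \<union> C) \<times> (B \<union> D)" "Domain (p \<union> q) = A \<union> C" "Range (p \<union> q) = B \<union> D"
    using p' q' by auto
  ultimately show ?thesis unfolding iso_graph_def by (blast intro: partial_isoI)
qed

lemma iso_graph_isomorphic:
  assumes p: "iso_graph (fst M) (snd M) (fst N) (snd N) p"
    and lin: "lin_on (fst M) (snd M)" "lin_on (fst N) (snd N)"
  shows "isomorphic M N"
proof -
  have iso: "partial_iso (fst M) (snd M) (fst N) (snd N) p"
    and dom: "Domain p = fst M" "Range p = fst N" using p by (auto simp: iso_graph_def)
  have "\<forall>x\<in>fst M. \<exists>y. (x, y) \<in> p" using dom(1) by blast
  then obtain f where f: "\<And>x. x \<in> fst M \<Longrightarrow> (x, f x) \<in> p" by metis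
  have inj: "x = x'" if "(x, y) \<in> p" "(x', y) \<in> p" for x x' y
    using partial_iso_single_valued[OF partial_iso_converse[OF iso] lin(2,1)] that by blast
  have "f ` fst M = fst N"
  proof (intro equalityI subsetI)
    fix y assume "y \<in> fst N"
    then obtain x where x: "(x, y) \<in> p" using dom by blast
    then have "x \<in> fst M" using dom by blast
    then have "y = f x" using partial_iso_single_valued[OF iso lin x] f by blast
    then show "y \<in> f ` fst M" using \<open>x \<in> fst M\<close> by blast
  qed (use f dom in blast)
  moreover have "inj_on f (fst M)" by (metis f inj inj_onI)
  ultimately have "bij_betw f (fst M) (fst N)" by (simp add: bij_betw_def)
  then show ?thesis
    unfolding isomorphic_def using partial_isoD(3)[OF iso] f by blast
qed

section \<open>Order type \<omega>: finite initial segments and no last point\<close>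

definition omega_on :: "'a set \<Rightarrow> 'a rel \<Rightarrow> bool" where
  "omega_on A r \<longleftrightarrow> lin_on A r \<and> A \<noteq> {} \<and> (\<forall>x\<in>A. \<exists>y\<in>A. (x, y) \<in> r \<and> x \<noteq> y) \<and>
     (\<forall>x\<in>A. finite {z\<in>A. (z, x) \<in> r})"

text \<open>Counting strict predecessors is the isomorphism onto the natural numbers. It increases
  strictly because a later point has all the predecessors of an earlier one and that point as well;
  it is onto because there is a first point and every point has an immediate successor.\<close>

lemma omega_on_rank:
  assumes om: "omega_on A r"
  defines "rk \<equiv> \<lambda>x. card {z\<in>A. (z, x) \<in> r \<and> z \<noteq> x}"
  shows "rk ` A = UNIV" and "\<And>x y. x \<in> A \<Longrightarrow> y \<in> A \<Longrightarrow> (x, y) \<in> r \<longleftrightarrow> rk x \<le> rk y"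
proof -
  have lin: "lin_on A r" using om by (simp add: omega_on_def)
  note lo = lin_on_trans[OF lin] lin_on_antisym[OF lin] lin_on_refl[OF lin] lin_on_total[OF lin]
  have fin: "finite {z\<in>A. (z, x) \<in> r \<and> z \<noteq> x}" if "x \<in> A" for x
    by (rule finite_subset[of _ "{z\<in>A. (z, x) \<in> r}"]) (use om that in \<open>auto simp: omega_on_def\<close>)
  have mono: "rk x < rk y" if "x \<in> A" "y \<in> A" "(x, y) \<in> r" "x \<noteq> y" for x y
    unfolding rk_def
  proof (rule psubset_card_mono[OF fin[OF that(2)]])
    have "{z\<in>A. (z, x) \<in> r \<and> z \<noteq> x} \<subseteq> {z\<in>A. (z, y) \<in> r \<and> z \<noteq> y}" using that lo by blast
    then show "{z\<in>A. (z, x) \<in> r \<and> z \<noteq> x} \<subset> {z\<in>A. (z, y) \<in> r \<and> z \<noteq> y}" using that by blast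
  qed
  show "(x, y) \<in> r \<longleftrightarrow> rk x \<le> rk y" if "x \<in> A" "y \<in> A" for x y
    using that lo(3,4) mono by (metis leD less_imp_le order_refl)
  have "\<exists>x\<in>A. rk x = n" for n
  proof (induction n)
    case 0
    obtain x where x: "x \<in> A" using om by (auto simp: omega_on_def)
    have "finite {z\<in>A. (z, x) \<in> r}" "{z\<in>A. (z, x) \<in> r} \<noteq> {}" "{z\<in>A. (z, x) \<in> r} \<subseteq> A"
      using om x lo(3) by (auto simp: omega_on_def)
    then obtain m where m: "m \<in> A" "(m, x) \<in> r" "\<forall>y\<in>A. (y, x) \<in> r \<longrightarrow> (m, y) \<in> r"
      using lin_on_finite_least[OF lin] by (metis (no_types, lifting) mem_Collect_eq)
    have "{z\<in>A. (z, m) \<in> r \<and> z \<noteq> m} = {}" using m lo x by blast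
    then show ?case using m(1) unfolding rk_def by (metis card.empty)
  next
    case (Suc n)
    then obtain x where x: "x \<in> A" "rk x = n" by blast
    obtain y where y: "y \<in> A" "(x, y) \<in> r" "x \<noteq> y" using om x(1) unfolding omega_on_def by blast
    \<comment> \<open>The interval from x, excluded, to y, included; it is finite as part of the
      initial segment of y. Its least point is the immediate successor of x, since a point strictly
      between the two would belong to \<open>?F\<close>.\<close>
    let ?F = "{z\<in>A. (x, z) \<in> r \<and> x \<noteq> z \<and> (z, y) \<in> r}"
    have "finite ?F"
      by (rule finite_subset[of _ "{z\<in>A. (z, y) \<in> r}"]) (use om y in \<open>auto simp: omega_on_def\<close>)
    moreover have "?F \<noteq> {}" "?F \<subseteq> A" using y lo(3) by auto
    ultimately obtain m where m: "m \<in> ?F" "\<forall>z\<in>?F. (m, z) \<in> r"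
      using lin_on_finite_least[OF lin] by blast
    have "z = x \<or> (z, x) \<in> r" if "z \<in> A" "(z, m) \<in> r" "z \<noteq> m" for z
    proof (rule ccontr)
      assume "\<not> (z = x \<or> (z, x) \<in> r)"
      then have "(x, z) \<in> r" "x \<noteq> z" using lo(4)[OF x(1) that(1)] by auto
      moreover have "(z, y) \<in> r" using lo(1)[OF that(2)] that(1) m(1) y(1) by simp
      ultimately have "(m, z) \<in> r" using m(2) that(1) by simp
      then show False using lo(2)[OF that(2)] that(1,3) m(1) by simp
    qed
    moreover have "(z, m) \<in> r \<and> z \<noteq> m" if "z \<in> A" "(z, x) \<in> r" for z
      using lo(1)[OF that(2), of m] lo(2)[of x m] that m(1) x(1) by auto
    ultimately have "{z\<in>A. (z, m) \<in> r \<and> z \<noteq> m} = insert x {z\<in>A. (z, x) \<in> r \<and> z \<noteq> x}"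
      using x(1) lo(3) by blast
    then have "rk m = Suc n" using fin[OF x(1)] x(2) by (simp add: rk_def)
    then show ?case using m(1) by blast
  qed
  then show "rk ` A = UNIV" by (metis UNIV_eq_I image_eqI)
qed

lemma omega_on_iso_graph:
  assumes A: "omega_on A r" and B: "omega_on B s"
  shows "\<exists>p. iso_graph A r B s p"
proof -
  define f where "f x = card {z\<in>A. (z, x) \<in> r \<and> z \<noteq> x}" for x
  define g where "g y = card {z\<in>B. (z, y) \<in> s \<and> z \<noteq> y}" for y
  have f: "f ` A = UNIV" "\<And>x y. x \<in> A \<Longrightarrow> y \<in> A \<Longrightarrow> (x, y) \<in> r \<longleftrightarrow> f x \<le> f y"
    using omega_on_rank[OF A] unfolding f_def by auto
  have g: "g ` B = UNIV" "\<And>x y. x \<in> B \<Longrightarrow> y \<in> B \<Longrightarrow> (x, y) \<in> s \<longleftrightarrow> g x \<le> g y"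
    using omega_on_rank[OF B] unfolding g_def by auto
  define p where "p = {(x, y). x \<in> A \<and> y \<in> B \<and> f x = g y}"
  have "partial_iso A r B s p" using f(2) g(2) by (auto simp: partial_iso_def p_def)
  moreover have "A \<subseteq> Domain p"
  proof
    fix x assume "x \<in> A"
    moreover obtain y where "y \<in> B" "g y = f x" using g(1) by (metis UNIV_I imageE)
    ultimately show "x \<in> Domain p" by (auto simp: p_def)
  qed
  moreover have "B \<subseteq> Range p"
  proof
    fix y assume "y \<in> B"
    moreover obtain x where "x \<in> A" "f x = g y" using f(1) by (metis UNIV_I imageE)
    ultimately show "y \<in> Range p" by (auto simp: p_def)
  qed
  ultimately have "iso_graph A r B s p" unfolding iso_graph_def by (auto simp: p_def)
  then show ?thesis by blast
qed

section \<open>The orders \<open>\<omega> + 1 + \<eta>\<close> and \<open>\<omega> + \<eta>\<close>\<close>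

definition less_in :: "struct \<Rightarrow> nat \<Rightarrow> nat \<Rightarrow> bool" where
  "less_in M x y \<longleftrightarrow> (x, y) \<in> snd M \<and> x \<noteq> y"

text \<open>The middle point is a. The last two clauses include the case x = a: there the former
  makes the part above a nonempty and the latter denies it a least point, so no separate axioms for
  \<eta> are required.\<close>

definition omega_one_eta :: "struct \<Rightarrow> nat \<Rightarrow> bool" where
  "omega_one_eta M a \<longleftrightarrow> lin_on (fst M) (snd M) \<and>
     (\<exists>x\<in>fst M. less_in M x a) \<and>
     (\<forall>x\<in>fst M. less_in M x a \<longrightarrow> (\<exists>y\<in>fst M. less_in M x y \<and> less_in M y a)) \<and>
     (\<forall>x\<in>fst M. (a, x) \<notin> snd M \<longrightarrow> finite {z\<in>fst M. (z, x) \<in> snd M}) \<and>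
     (\<forall>x\<in>fst M. (a, x) \<in> snd M \<longrightarrow> (\<exists>y\<in>fst M. less_in M x y)) \<and>
     (\<forall>x\<in>fst M. \<forall>y\<in>fst M. (a, x) \<in> snd M \<and> less_in M x y \<longrightarrow>
        (\<exists>z\<in>fst M. less_in M x z \<and> less_in M z y))"

lemma omega_one_eta_parts:
  assumes M: "omega_one_eta M a" and a: "a \<in> fst M"
  defines "L \<equiv> {x\<in>fst M. less_in M x a}" and "U \<equiv> {x\<in>fst M. less_in M a x}"
  shows "omega_on L (snd M)" "dlo_on U (snd M)" "fst M = L \<union> {a} \<union> U"
proof -
  have lin: "lin_on (fst M) (snd M)" using M by (simp add: omega_one_eta_def)
  note lo = lin_on_trans[OF lin] lin_on_antisym[OF lin] lin_on_refl[OF lin] lin_on_total[OF lin]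
  have sub: "L \<subseteq> fst M" "U \<subseteq> fst M" by (auto simp: L_def U_def)
  have nL: "(a, x) \<notin> snd M" if "x \<in> L" for x
    using that lo(2) a by (auto simp: L_def less_in_def)
  have "finite {z\<in>L. (z, x) \<in> snd M}" if "x \<in> L" for x
  proof (rule finite_subset)
    show "finite {z\<in>fst M. (z, x) \<in> snd M}"
      using M nL[OF that] that sub by (auto simp: omega_one_eta_def)
  qed (use sub in blast)
  moreover have "L \<noteq> {}" using M by (auto simp: omega_one_eta_def L_def)
  moreover have "\<exists>y\<in>L. (x, y) \<in> snd M \<and> x \<noteq> y" if "x \<in> L" for x
    using M that unfolding omega_one_eta_def L_def less_in_def by blast
  ultimately show "omega_on L (snd M)"
    using lin_on_subset[OF lin sub(1)] by (simp add: omega_on_def)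
  have above: "less_in M a y" if "(a, x) \<in> snd M" "less_in M x y" "x \<in> fst M" "y \<in> fst M" for x y
    using that lo(1,2) a unfolding less_in_def by blast
  have up: "\<exists>y\<in>U. less_in M x y" if "x \<in> fst M" "(a, x) \<in> snd M" for x
    using M that above unfolding omega_one_eta_def U_def by blast
  have betw: "\<exists>z\<in>U. less_in M x z \<and> less_in M z y"
    if "x \<in> fst M" "y \<in> fst M" "(a, x) \<in> snd M" "less_in M x y" for x y
    using M that above unfolding omega_one_eta_def U_def by blast
  have "U \<noteq> {}" using up[OF a lo(3)[OF a]] by blast
  moreover have "\<forall>x\<in>U. \<exists>y\<in>U. (x, y) \<in> snd M \<and> x \<noteq> y"
    using up unfolding U_def less_in_def by blast
  moreover have "\<forall>x\<in>U. \<exists>y\<in>U. (y, x) \<in> snd M \<and> x \<noteq> y"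
    using betw[OF a _ lo(3)[OF a]] unfolding U_def less_in_def by blast
  moreover have "\<forall>x\<in>U. \<forall>y\<in>U. (x, y) \<in> snd M \<and> x \<noteq> y \<longrightarrow>
      (\<exists>z\<in>U. (x, z) \<in> snd M \<and> x \<noteq> z \<and> (z, y) \<in> snd M \<and> z \<noteq> y)"
    using betw unfolding U_def less_in_def by blast
  ultimately show "dlo_on U (snd M)"
    using lin_on_subset[OF lin sub(2)] by (simp add: dlo_on_def)
  show "fst M = L \<union> {a} \<union> U" using a lo(4) by (auto simp: L_def U_def less_in_def)
qed

lemma omega_one_eta_unique:
  assumes M: "omega_one_eta M a" "a \<in> fst M" and N: "omega_one_eta N b" "b \<in> fst N"
  shows "isomorphic M N"
proof -
  let ?LM = "{x\<in>fst M. less_in M x a}" and ?UM = "{x\<in>fst M. less_in M a x}"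
  let ?LN = "{x\<in>fst N. less_in N x b}" and ?UN = "{x\<in>fst N. less_in N b x}"
  have lin: "lin_on (fst M) (snd M)" "lin_on (fst N) (snd N)"
    using assms by (auto simp: omega_one_eta_def)
  note m = omega_one_eta_parts[OF M] and n = omega_one_eta_parts[OF N]
  obtain p where p: "iso_graph ?LM (snd M) ?LN (snd N) p"
    using omega_on_iso_graph[OF m(1) n(1)] by blast
  obtain q where q: "iso_graph ?UM (snd M) ?UN (snd N) q"
    using dlo_on_iso_graph[OF m(2) n(2)] by blast
  have c: "iso_graph {a} (snd M) {b} (snd N) {(a, b)}"
    using lin_on_refl[OF lin(1) M(2)] lin_on_refl[OF lin(2) N(2)]
    by (auto simp: iso_graph_def partial_iso_def)
  have sep: "(x, y) \<in> snd K \<and> (y, x) \<notin> snd K"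
    if "x \<in> {x\<in>fst K. less_in K x c} \<union> {c}" "y \<in> {x\<in>fst K. less_in K c x}"
      "lin_on (fst K) (snd K)" "c \<in> fst K" for K x y c
    using that lin_on_trans[OF that(3)] lin_on_antisym[OF that(3)] unfolding less_in_def by blast
  have sep': "(x, y) \<in> snd K \<and> (y, x) \<notin> snd K"
    if "x \<in> {x\<in>fst K. less_in K x c}" "y \<in> {c}"
      "lin_on (fst K) (snd K)" "c \<in> fst K" for K x y c
    using that lin_on_antisym[OF that(3)] unfolding less_in_def by blast
  have "iso_graph (?LM \<union> {a}) (snd M) (?LN \<union> {b}) (snd N) (p \<union> {(a, b)})"
    by (rule iso_graph_Un[OF p c]) (use sep' lin M(2) N(2) in blast)+
  then have "iso_graph (?LM \<union> {a} \<union> ?UM) (snd M) (?LN \<union> {b} \<union> ?UN) (snd N) (p \<union> {(a, b)} \<union> q)"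
    by (rule iso_graph_Un[OF _ q]) (use sep lin M(2) N(2) in blast)+
  then show ?thesis using iso_graph_isomorphic lin m(3) n(3) by metis
qed

section \<open>Copies of the two orders in the rationals, coded by natural numbers\<close>

definition rat_struct :: "rat set \<Rightarrow> struct" where
  "rat_struct X = (to_nat ` X, {(to_nat x, to_nat y) | x y. x \<in> X \<and> y \<in> X \<and> x \<le> y})"

lemma fst_rat_struct [simp]: "fst (rat_struct X) = to_nat ` X"
  by (simp add: rat_struct_def)

lemma snd_rat_struct [simp]:
  "(to_nat x, to_nat y) \<in> snd (rat_struct X) \<longleftrightarrow> x \<in> X \<and> y \<in> X \<and> x \<le> y"
  by (auto simp: rat_struct_def)

lemma less_in_rat_struct [simp]:
  "less_in (rat_struct X) (to_nat x) (to_nat y) \<longleftrightarrow> x \<in> X \<and> y \<in> X \<and> x < y"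
  by (auto simp: less_in_def)

lemma is_struct_rat_struct: "X \<noteq> {} \<Longrightarrow> is_struct (rat_struct X)"
  by (auto simp: is_struct_def rat_struct_def)

lemma linear_order_on_rat_struct: "linear_order_on (fst (rat_struct X)) (snd (rat_struct X))"
  unfolding linear_order_on_def partial_order_on_def preorder_on_def rat_struct_def
  by (auto simp: refl_on_def trans_def antisym_def total_on_def)

lemma lin_on_rat_struct: "lin_on (fst (rat_struct X)) (snd (rat_struct X))"
  unfolding lin_on_def by auto

text \<open>An increasing sequence of negative rationals with supremum 0. This leaves 0 for the
  middle point and all positive rationals for \<eta>, so that dropping the middle point changes
  nothing else.\<close>

definition omega_pt :: "nat \<Rightarrow> rat" where
  "omega_pt n = - 1 / (of_nat n + 1)"

lemma omega_pt_le_iff [simp]: "omega_pt m \<le> omega_pt n \<longleftrightarrow> m \<le> n"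
  by (auto simp: omega_pt_def field_simps)

lemma omega_pt_less_iff [simp]: "omega_pt m < omega_pt n \<longleftrightarrow> m < n"
  by (simp add: less_le_not_le)

lemma omega_pt_neg [simp]: "omega_pt n < 0"
  by (simp add: omega_pt_def)

lemma omega_pt_neq_0 [simp]: "omega_pt n \<noteq> 0"
  using omega_pt_neg[of n] by linarith

definition omega_eta_rat :: "rat set" where
  "omega_eta_rat = range omega_pt \<union> {0<..}"

definition omega_one_eta_rat :: "rat set" where
  "omega_one_eta_rat = insert 0 omega_eta_rat"

lemma omega_one_eta_rat_struct:
  "omega_one_eta (rat_struct omega_one_eta_rat) (to_nat (0 :: rat))"
proof -
  let ?A = omega_one_eta_rat
  have mem: "0 \<in> ?A" "omega_pt n \<in> ?A" "x > 0 \<Longrightarrow> x \<in> ?A" for n x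
    by (auto simp: omega_one_eta_rat_def omega_eta_rat_def)
  have neg: "\<exists>n. x = omega_pt n" if "x \<in> ?A" "x < 0" for x
    using that by (auto simp: omega_one_eta_rat_def omega_eta_rat_def)
  have 1: "\<exists>x\<in>?A. x < 0" using mem(2)[of 0] omega_pt_neg by blast
  have 2: "\<exists>y\<in>?A. x < y \<and> y < 0" if x: "x \<in> ?A" "x < 0" for x
  proof -
    obtain n where "x = omega_pt n" using neg x by blast
    then show ?thesis using mem(2)[of "Suc n"] by (metis lessI omega_pt_less_iff omega_pt_neg)
  qed
  have 3: "finite {z \<in> to_nat ` ?A. (z, to_nat x) \<in> snd (rat_struct ?A)}"
    if x: "x \<in> ?A" "x < 0" for x
  proof -
    obtain n where n: "x = omega_pt n" using neg x by blast
    have "{z \<in> to_nat ` ?A. (z, to_nat x) \<in> snd (rat_struct ?A)} \<subseteq> to_nat ` omega_pt ` {..n}"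
    proof
      fix z assume "z \<in> {z \<in> to_nat ` ?A. (z, to_nat x) \<in> snd (rat_struct ?A)}"
      then obtain y where y: "z = to_nat y" "y \<in> ?A" "y \<le> x" by auto
      then obtain m where "y = omega_pt m" using neg[of y] x by auto
      then show "z \<in> to_nat ` omega_pt ` {..n}" using y n by auto
    qed
    then show ?thesis by (rule finite_subset) simp
  qed
  have 4: "\<exists>y\<in>?A. x < y" if "0 \<le> x" for x
    using mem(3)[of "x + 1"] that by force
  have 5: "\<exists>z\<in>?A. x < z \<and> z < y" if xy: "0 \<le> x" "x < y" for x y
  proof -
    obtain z where "x < z" "z < y" using dense xy(2) by blast
    then show ?thesis using mem(3)[of z] xy(1) by auto
  qed
  show ?thesis
    unfolding omega_one_eta_def
    using 1 2 3 4 5 lin_on_rat_struct by (simp add: mem(1) not_le)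
qed

text \<open>A middle point is a limit from below, and each point below it has finitely many
  predecessors. A point of \<omega> fails the former, having an immediate predecessor or none; a
  point a of \<eta> fails the latter, as a / 2 already lies above all of \<omega>.\<close>

lemma not_omega_one_eta_omega_eta:
  assumes "a \<in> omega_eta_rat"
  shows "\<not> omega_one_eta (rat_struct omega_eta_rat) (to_nat a)"
proof
  let ?B = omega_eta_rat
  assume ax: "omega_one_eta (rat_struct ?B) (to_nat a)"
  have pts: "omega_pt n \<in> ?B" for n by (auto simp: omega_eta_rat_def)
  consider n where "a = omega_pt n" | "a > 0" using assms by (auto simp: omega_eta_rat_def)
  then show False
  proof cases
    case (1 n)
    have neg: "\<exists>m. x = omega_pt m" if "x \<in> ?B" "x < a" for x
      using that 1 omega_pt_neg[of n] by (auto simp: omega_eta_rat_def simp del: omega_pt_neg)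
    have lim: "\<exists>x\<in>?B. x < a" "\<forall>x\<in>?B. x < a \<longrightarrow> (\<exists>y\<in>?B. x < y \<and> y < a)"
      using ax assms by (auto simp: omega_one_eta_def)
    obtain m where "omega_pt m < a" using lim(1) neg by blast
    then have "n > 0" using 1 by simp
    then have "omega_pt (n - 1) < a" using 1 by simp
    then obtain y where "y \<in> ?B" "omega_pt (n - 1) < y" "y < a" using lim(2) pts by blast
    then obtain k where "omega_pt (n - 1) < omega_pt k" "omega_pt k < omega_pt n" using neg 1 by blast
    then show False by simp
  next
    case 2
    then have "a / 2 \<in> ?B" "a / 2 < a" "a / 2 > 0" by (auto simp: omega_eta_rat_def)
    then have "finite {z \<in> to_nat ` ?B. (z, to_nat (a / 2)) \<in> snd (rat_struct ?B)}"
      using ax by (simp add: omega_one_eta_def not_le)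
    moreover have "to_nat ` omega_pt ` UNIV \<subseteq> {z \<in> to_nat ` ?B. (z, to_nat (a / 2)) \<in> snd (rat_struct ?B)}"
    proof -
      have "omega_pt n \<le> a / 2" for n
        using omega_pt_neg[of n] \<open>a / 2 > 0\<close> by linarith
      then show ?thesis using pts \<open>a / 2 \<in> ?B\<close> by (auto simp del: divide_le_eq_numeral1 le_divide_eq_numeral1)
    qed
    ultimately have "finite (to_nat ` omega_pt ` UNIV)" by (rule rev_finite_subset)
    moreover have "inj (to_nat \<circ> omega_pt)"
      by (rule inj_compose) (auto intro!: injI simp: order.eq_iff)
    ultimately show False
      using finite_imageD[of "to_nat \<circ> omega_pt" UNIV] by (simp add: image_comp)
  qed
qed

section \<open>The Scott sentence\<close>

definition fin_conj :: "fm list \<Rightarrow> fm" where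
  "fin_conj \<phi>s = ConjF (acset (set \<phi>s))"

definition fin_disj :: "fm list \<Rightarrow> fm" where
  "fin_disj \<phi>s = DisjF (acset (set \<phi>s))"

lemma rcset_acset [simp]: "countable S \<Longrightarrow> rcset (acset S) = S"
  by (simp add: acset_inverse)

lemma sat_fin_conj [simp]: "sat (fin_conj \<phi>s) M e \<longleftrightarrow> (\<forall>\<phi>\<in>set \<phi>s. sat \<phi> M e)"
  by (simp add: fin_conj_def countable_finite)

lemma sat_fin_disj [simp]: "sat (fin_disj \<phi>s) M e \<longleftrightarrow> (\<exists>\<phi>\<in>set \<phi>s. sat \<phi> M e)"
  by (simp add: fin_disj_def countable_finite)

lemma fv_fin_conj [simp]: "fv (fin_conj \<phi>s) = (\<Union>\<phi>\<in>set \<phi>s. fv \<phi>)"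
  by (simp add: fin_conj_def countable_finite)

lemma fv_fin_disj [simp]: "fv (fin_disj \<phi>s) = (\<Union>\<phi>\<in>set \<phi>s. fv \<phi>)"
  by (simp add: fin_disj_def countable_finite)

lemma qf_fin_conj [simp]: "\<forall>\<phi>\<in>set \<phi>s. qf \<phi> \<Longrightarrow> qf (fin_conj \<phi>s)"
  unfolding fin_conj_def by (rule qf.intros) (auto simp: countable_finite)

lemma qf_fin_disj [simp]: "\<forall>\<phi>\<in>set \<phi>s. qf \<phi> \<Longrightarrow> qf (fin_disj \<phi>s)"
  unfolding fin_disj_def by (rule qf.intros) (auto simp: countable_finite)

declare qf.intros(1-3)[simp]

definition LtF :: "nat \<Rightarrow> nat \<Rightarrow> fm" where
  "LtF x y = fin_conj [LeF x y, NegF (EqF x y)]"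

lemma sat_LtF [simp]: "sat (LtF x y) M e \<longleftrightarrow> less_in M (e x) (e y)"
  by (simp add: LtF_def less_in_def)

lemma fv_LtF [simp]: "fv (LtF x y) = {x, y}"
  by (auto simp: LtF_def)

lemma qf_LtF [simp]: "qf (LtF x y)"
  unfolding LtF_def by (rule qf_fin_conj) auto

text \<open>Variable 1 has at most \<open>n\<close> predecessors, itself included.\<close>

definition at_most_below :: "nat \<Rightarrow> fm" where
  "at_most_below n =
     foldr ExF [3..<n + 3] (fin_conj [AllF 2 (fin_disj (NegF (LeF 2 1) # map (EqF 2) [3..<n + 3]))])"

text \<open>The block variables 3, ..., n + 2 list points covering the initial segment; variable 0
  is reserved for the middle point and 2 for the universal quantifier. Repetitions in the list are
  allowed, so any enumeration of a finite segment, shifted by 3, provides witnesses.\<close>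

lemma sat_at_most_below:
  assumes "e 1 \<in> fst M"
  shows "(\<exists>n. sat (at_most_below n) M e) \<longleftrightarrow> finite {z\<in>fst M. (z, e 1) \<in> snd M}"
proof -
  let ?Z = "{z\<in>fst M. (z, e 1) \<in> snd M}"
  have iff: "sat (at_most_below n) M e \<longleftrightarrow>
      (\<exists>e'\<in>updates M [3..<n + 3] e. ?Z \<subseteq> e' ` {3..<n + 3})" for n
  proof -
    have "e' 1 = e 1" if "e' \<in> updates M [3..<n + 3] e" for e'
      using that by (simp add: updates_def)
    then show ?thesis
      unfolding at_most_below_def sat_foldr_ExF by (intro bex_cong refl) (auto simp: image_iff)
  qed
  show ?thesis
  proof
    assume "\<exists>n. sat (at_most_below n) M e"
    then obtain e' n where "?Z \<subseteq> e' ` {3..<n + 3 :: nat}" unfolding iff by blast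
    then show "finite ?Z" by (rule finite_subset) simp
  next
    assume fin: "finite ?Z"
    then obtain n and h :: "nat \<Rightarrow> nat" where h: "?Z = h ` {i. i < n}"
      using finite_imp_nat_seg_image_inj_on by metis
    define e' where "e' x = (if x \<in> {3..<n + 3} then h (x - 3) else e x)" for x
    have "h i \<in> ?Z" if "i < n" for i using that h by blast
    then have "e' \<in> updates M [3..<n + 3] e" unfolding updates_def e'_def by auto
    moreover have "?Z \<subseteq> e' ` {3..<n + 3}"
    proof
      fix z assume "z \<in> ?Z"
      then obtain i where "i < n" "z = h i" using h by blast
      then have "z = e' (i + 3)" "i + 3 \<in> {3..<n + 3}" by (auto simp: e'_def)
      then show "z \<in> e' ` {3..<n + 3}" by blast
    qed
    ultimately show "\<exists>n. sat (at_most_below n) M e" unfolding iff by blast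
  qed
qed

text \<open>The exception for points not below the middle point is one more disjunct, so the
  implication stays a single \<open>\<Sigma>\<^sub>2\<close> disjunction. Finiteness is the one
  property in the Scott sentence that calls for an infinite disjunction.\<close>

definition finitely_many_below :: fm where
  "finitely_many_below = DisjF (acset (insert (LeF 0 1) (range at_most_below)))"

lemma sat_finitely_many_below [simp]:
  "e 1 \<in> fst M \<Longrightarrow> sat finitely_many_below M e \<longleftrightarrow>
     ((e 0, e 1) \<notin> snd M \<longrightarrow> finite {z\<in>fst M. (z, e 1) \<in> snd M})"
  using sat_at_most_below[of e M] by (auto simp: finitely_many_below_def)

text \<open>At nonzero rank \<open>is_Sigma\<close> accepts only formulas that are literally
  disjunctions, so a lone existential block is wrapped as a disjunction with one member.\<close>

definition ex_qf :: "nat list \<Rightarrow> fm \<Rightarrow> fm" where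
  "ex_qf xs \<phi> = fin_disj [foldr ExF xs \<phi>]"

text \<open>Variable 0 is the middle point; the conjuncts are listed in the order of the definition of
  \<^const>\<open>omega_one_eta\<close>, linearity taking the first four.\<close>

definition middle_axioms :: "fm list" where
  "middle_axioms =
    [AllF 1 (LeF 1 1),
     AllF 1 (AllF 2 (fin_disj [NegF (LeF 1 2), NegF (LeF 2 1), EqF 1 2])),
     AllF 1 (AllF 2 (AllF 3 (fin_disj [NegF (LeF 1 2), NegF (LeF 2 3), LeF 1 3]))),
     AllF 1 (AllF 2 (fin_disj [LeF 1 2, LeF 2 1])),
     ex_qf [1] (LtF 1 0),
     AllF 1 (ex_qf [2] (fin_disj [NegF (LtF 1 0), fin_conj [LtF 1 2, LtF 2 0]])),
     AllF 1 finitely_many_below,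
     AllF 1 (ex_qf [2] (fin_disj [NegF (LeF 0 1), LtF 1 2])),
     AllF 1 (AllF 2 (ex_qf [3]
       (fin_disj [NegF (LeF 0 1), NegF (LtF 1 2), fin_conj [LtF 1 3, LtF 3 2]])))]"

definition scott_fm :: fm where
  "scott_fm = fin_disj [ExF 0 (fin_conj middle_axioms)]"

lemma sat_middle_axioms:
  assumes "e 0 \<in> fst M"
  shows "sat (fin_conj middle_axioms) M e \<longleftrightarrow> omega_one_eta M (e 0)"
proof -
  let ?D = "fst M" and ?R = "snd M" and ?lt = "less_in M" and ?a = "e 0"
  have "sat (AllF 1 (LeF 1 1)) M e \<longleftrightarrow> (\<forall>x\<in>?D. (x, x) \<in> ?R)"
    by simp
  moreover have "sat (AllF 1 (AllF 2 (fin_disj [NegF (LeF 1 2), NegF (LeF 2 1), EqF 1 2]))) M e \<longleftrightarrow>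
      (\<forall>x\<in>?D. \<forall>y\<in>?D. (x, y) \<in> ?R \<longrightarrow> (y, x) \<in> ?R \<longrightarrow> x = y)"
    by (simp, blast)
  moreover have "sat (AllF 1 (AllF 2 (AllF 3 (fin_disj [NegF (LeF 1 2), NegF (LeF 2 3), LeF 1 3])))) M e
      \<longleftrightarrow> (\<forall>x\<in>?D. \<forall>y\<in>?D. \<forall>z\<in>?D. (x, y) \<in> ?R \<longrightarrow> (y, z) \<in> ?R \<longrightarrow> (x, z) \<in> ?R)"
    by (simp, blast)
  moreover have "sat (AllF 1 (AllF 2 (fin_disj [LeF 1 2, LeF 2 1]))) M e \<longleftrightarrow>
      (\<forall>x\<in>?D. \<forall>y\<in>?D. (x, y) \<in> ?R \<or> (y, x) \<in> ?R)"
    by simp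
  moreover have "sat (ex_qf [1] (LtF 1 0)) M e \<longleftrightarrow> (\<exists>x\<in>?D. ?lt x ?a)"
    by (simp add: ex_qf_def)
  \<comment> \<open>The existential quantifier stands in front of the implication, so a witness is
    due even when the premise fails; then any point serves, for instance \<open>e 0\<close>.\<close>
  moreover have "sat (AllF 1 (ex_qf [2] (fin_disj [NegF (LtF 1 0), fin_conj [LtF 1 2, LtF 2 0]]))) M e
      \<longleftrightarrow> (\<forall>x\<in>?D. ?lt x ?a \<longrightarrow> (\<exists>y\<in>?D. ?lt x y \<and> ?lt y ?a))"
    using assms by (simp add: ex_qf_def) blast
  moreover have "sat (AllF 1 finitely_many_below) M e \<longleftrightarrow>
      (\<forall>x\<in>?D. (?a, x) \<notin> ?R \<longrightarrow> finite {z\<in>?D. (z, x) \<in> ?R})"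
    by simp
  moreover have "sat (AllF 1 (ex_qf [2] (fin_disj [NegF (LeF 0 1), LtF 1 2]))) M e \<longleftrightarrow>
      (\<forall>x\<in>?D. (?a, x) \<in> ?R \<longrightarrow> (\<exists>y\<in>?D. ?lt x y))"
    using assms by (simp add: ex_qf_def) blast
  moreover have "sat (AllF 1 (AllF 2 (ex_qf [3]
       (fin_disj [NegF (LeF 0 1), NegF (LtF 1 2), fin_conj [LtF 1 3, LtF 3 2]])))) M e \<longleftrightarrow>
      (\<forall>x\<in>?D. \<forall>y\<in>?D. (?a, x) \<in> ?R \<and> ?lt x y \<longrightarrow> (\<exists>z\<in>?D. ?lt x z \<and> ?lt z y))"
    using assms by (simp add: ex_qf_def) blast
  ultimately show ?thesis
    unfolding omega_one_eta_def lin_on_def middle_axioms_def sat_fin_conj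
    by (simp only: list.set ball_simps simp_thms conj_assoc)
qed

lemma sat_scott_fm: "sat scott_fm M e \<longleftrightarrow> (\<exists>a\<in>fst M. omega_one_eta M a)"
proof -
  have "sat (fin_conj middle_axioms) M (e(0 := a)) \<longleftrightarrow> omega_one_eta M a" if "a \<in> fst M" for a
    using sat_middle_axioms[of "e(0 := a)" M] that by (simp del: sat_fin_conj)
  then show ?thesis by (simp add: scott_fm_def del: sat_fin_conj)
qed

lemma models_scott_fm:
  "is_struct M \<Longrightarrow> models M scott_fm \<longleftrightarrow> (\<exists>a\<in>fst M. omega_one_eta M a)"
proof -
  assume "is_struct M"
  then obtain b where "b \<in> fst M" by (auto simp: is_struct_def)
  then have "range (\<lambda>_ :: nat. b) \<subseteq> fst M" by auto
  then show ?thesis unfolding models_def sat_scott_fm by blast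
qed

lemma sentence_scott_fm: "sentence scott_fm"
proof -
  have "fv (at_most_below n) \<subseteq> {1}" for n by (auto simp: at_most_below_def)
  then have "fv finitely_many_below \<subseteq> {0, 1}" by (auto simp: finitely_many_below_def)
  then show ?thesis
    by (auto simp: sentence_def scott_fm_def middle_axioms_def ex_qf_def)
qed

lemma scott_sentence_scott_fm: "scott_sentence (rat_struct omega_one_eta_rat) scott_fm"
  unfolding scott_sentence_def
proof (intro conjI allI impI iffI)
  let ?A = "rat_struct omega_one_eta_rat"
  have A: "to_nat (0 :: rat) \<in> fst ?A" "is_struct ?A"
    using is_struct_rat_struct[of omega_one_eta_rat] by (auto simp: omega_one_eta_rat_def)
  fix N assume N: "is_struct N"
  show "isomorphic ?A N" if "models N scott_fm"
    using that omega_one_eta_unique[OF omega_one_eta_rat_struct A(1)] models_scott_fm[OF N] by blast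
  show "models N scott_fm" if "isomorphic ?A N"
    using models_isomorphic[OF that sentence_scott_fm] A omega_one_eta_rat_struct
      models_scott_fm[OF A(2)] by blast
qed (rule sentence_scott_fm)

text \<open>The Scott sentence itself is the invariant: an isomorphic copy would satisfy it and so
  contain a middle point.\<close>

lemma not_isomorphic_omega_eta:
  "\<not> isomorphic (rat_struct omega_one_eta_rat) (rat_struct omega_eta_rat)"
proof
  assume iso: "isomorphic (rat_struct omega_one_eta_rat) (rat_struct omega_eta_rat)"
  have "is_struct (rat_struct omega_eta_rat)"
    by (rule is_struct_rat_struct) (auto simp: omega_eta_rat_def)
  then have "\<exists>a\<in>fst (rat_struct omega_eta_rat). omega_one_eta (rat_struct omega_eta_rat) a"
    using iso scott_sentence_scott_fm models_scott_fm unfolding scott_sentence_def by blast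
  then show False using not_omega_one_eta_omega_eta by auto
qed

section \<open>Finite ranks among arbitrary well-orders of natural numbers\<close>

lemma natLeq_on_less:
  assumes "m < n"
  shows "natLeq_on m <o natLeq_on n"
proof -
  \<comment> \<open>The segment below m is literally \<open>natLeq_on m\<close>, so reflexivity
    provides the isomorphism that characterises \<open><o\<close>.\<close>
  have "Restr (natLeq_on n) (underS (natLeq_on n) m) = natLeq_on m"
    using assms by (auto simp: underS_def)
  moreover have "m \<in> Field (natLeq_on n)" using assms by (simp add: Field_natLeq_on)
  moreover have "natLeq_on m =o natLeq_on m" by (rule ordIso_reflexive[OF natLeq_on_Well_order])
  ultimately have "\<exists>a\<in>Field (natLeq_on n). natLeq_on m =o Restr (natLeq_on n) (underS (natLeq_on n) a)"
    by (intro bexI[of _ m]) (simp_all only:)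
  then show ?thesis
    by (rule ordLess_iff_ordIso_Restr[OF natLeq_on_Well_order natLeq_on_Well_order, THEN iffD2])
qed

text \<open>Formula ranks are arbitrary well-orders, whereas the game counts its moves in natural
  numbers. A well-order below n + 1 is isomorphic to the initial segment cut off at some a \<le>
  n.\<close>

lemma ordLess_natLeq_on_Suc:
  assumes "\<gamma> <o natLeq_on (Suc n)"
  shows "\<gamma> \<le>o natLeq_on n"
proof -
  have wo: "Well_order \<gamma>" using assms by (simp add: ordLess_def)
  obtain a where a: "a \<in> Field (natLeq_on (Suc n))"
      "\<gamma> =o Restr (natLeq_on (Suc n)) (underS (natLeq_on (Suc n)) a)"
    using ordLess_iff_ordIso_Restr[OF natLeq_on_Well_order[of "Suc n"] wo] assms by blast
  have an: "a \<le> n" using a(1) by (simp add: Field_natLeq_on)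
  then have "Restr (natLeq_on (Suc n)) (underS (natLeq_on (Suc n)) a) = natLeq_on a"
    by (auto simp: underS_def)
  then have "\<gamma> =o natLeq_on a" using a(2) by metis
  moreover have "natLeq_on a \<le>o natLeq_on n"
    using an natLeq_on_less[of a n] ordLess_imp_ordLeq ordLeq_reflexive[OF natLeq_on_Well_order[of n]]
    by (cases "a = n") auto
  ultimately show ?thesis by (rule ordIso_ordLeq_trans)
qed

text \<open>Rank 0 is recognised by equality with the empty relation, so a comparison of order types
  has to become an equation. A point of the field of r lies below itself, and an embedding would map
  this nonempty segment onto an empty one.\<close>

lemma ordLeq_empty:
  fixes r :: "'a rel" and s :: "'b rel"
  assumes "r \<le>o s" "s = {}"
  shows "r = {}"
proof (rule ccontr)
  assume "r \<noteq> {}"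
  then obtain a where a: "a \<in> Field r" by (auto simp: Field_def)
  have "Well_order r" using assms(1) by (simp add: ordLeq_def)
  then have "a \<in> under r a"
    using a by (auto simp: under_def order_on_defs refl_on_def)
  moreover obtain f where "embed r s f" using assms(1) by (auto simp: ordLeq_def)
  then have "bij_betw f (under r a) (under s (f a))" using a by (simp add: embed_def)
  moreover have "under s (f a) = {}" using assms(2) by (simp add: under_def)
  ultimately show False by (simp add: bij_betw_def)
qed

lemma natLeq_on_nonempty: "n > 0 \<Longrightarrow> natLeq_on n \<noteq> {}"
  by auto

text \<open>The rank enters the disjuncts only as a strict upper bound, so transitivity suffices.
  Rank 0 is different, as a quantifier-free formula need not be a disjunction at all.\<close>

lemma is_Sigma_mono:
  assumes "is_Sigma \<beta> \<phi>" "\<beta> \<noteq> {}" "\<beta> \<le>o \<alpha>"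
  shows "is_Sigma \<alpha> \<phi>"
  using assms(1)
proof cases
  case (2 \<Psi>)
  have "\<alpha> \<noteq> {}" using ordLeq_empty[OF assms(3)] assms(2) by blast
  then show ?thesis unfolding 2(1)
  proof (rule is_Sigma_is_Pi.intros)
    fix \<psi> assume "\<psi> \<in> rcset \<Psi>"
    then obtain \<gamma> xs \<chi> where "\<gamma> <o \<beta>" "is_Pi \<gamma> \<chi>" "\<psi> = foldr ExF xs \<chi>" using 2 by metis
    then show "\<exists>\<gamma> xs \<chi>. \<gamma> <o \<alpha> \<and> is_Pi \<gamma> \<chi> \<and> \<psi> = foldr ExF xs \<chi>"
      using ordLess_ordLeq_trans[OF _ assms(3)] by blast
  qed
qed (use assms in simp)

section \<open>Rank of the Scott sentence\<close>

lemma is_Sigma_ex_qf: "qf \<phi> \<Longrightarrow> is_Sigma (natLeq_on 1) (ex_qf xs \<phi>)"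
  unfolding ex_qf_def fin_disj_def
proof (rule is_Sigma_is_Pi.intros)
  fix \<psi> assume "qf \<phi>" "\<psi> \<in> rcset (acset (set [foldr ExF xs \<phi>]))"
  moreover have "({} :: nat rel) <o natLeq_on 1" using natLeq_on_less[of 0 1] by simp
  ultimately show "\<exists>\<beta> xs \<phi>. \<beta> <o natLeq_on 1 \<and> is_Pi \<beta> \<phi> \<and> \<psi> = foldr ExF xs \<phi>"
    using is_Sigma_is_Pi.intros(2) by auto
qed (rule natLeq_on_nonempty, simp)

lemma is_Sigma_finitely_many_below: "is_Sigma (natLeq_on 2) finitely_many_below"
  unfolding finitely_many_below_def
proof (rule is_Sigma_is_Pi.intros)
  fix \<psi> assume "\<psi> \<in> rcset (acset (insert (LeF 0 1) (range at_most_below)))"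
  then consider "\<psi> = LeF 0 1" | n where "\<psi> = at_most_below n" by auto
  then show "\<exists>\<beta> xs \<phi>. \<beta> <o natLeq_on 2 \<and> is_Pi \<beta> \<phi> \<and> \<psi> = foldr ExF xs \<phi>"
  proof cases
    case 1
    have "({} :: nat rel) <o natLeq_on 2" using natLeq_on_less[of 0 2] by simp
    moreover have "is_Pi {} \<psi>" unfolding 1 by (intro is_Sigma_is_Pi.intros qf.intros)
    moreover have "\<psi> = foldr ExF [] \<psi>" by simp
    ultimately show ?thesis by blast
  next
    case (2 n)
    let ?\<chi> = "fin_disj (NegF (LeF 2 1) # map (EqF 2) [3..<n + 3])"
    have "is_Pi (natLeq_on 1) (fin_conj [AllF 2 ?\<chi>])"
      unfolding fin_conj_def
    proof (rule is_Sigma_is_Pi.intros)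
      fix \<theta> assume "\<theta> \<in> rcset (acset (set [AllF 2 ?\<chi>]))"
      then have "\<theta> = foldr AllF [2] ?\<chi>" by simp
      moreover have "({} :: nat rel) <o natLeq_on 1" using natLeq_on_less[of 0 1] by simp
      moreover have "is_Sigma {} ?\<chi>"
        by (rule is_Sigma_is_Pi.intros, rule qf_fin_disj) auto
      ultimately show "\<exists>\<beta> xs \<phi>. \<beta> <o natLeq_on 1 \<and> is_Sigma \<beta> \<phi> \<and> \<theta> = foldr AllF xs \<phi>" by blast
    qed (rule natLeq_on_nonempty, simp)
    then show ?thesis unfolding 2 at_most_below_def using natLeq_on_less[of 1 2] by auto
  qed
qed (rule natLeq_on_nonempty, simp)

lemma is_Pi_middle_axioms: "is_Pi (natLeq_on 3) (fin_conj middle_axioms)"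
proof -
  have lt: "({} :: nat rel) <o natLeq_on 3" "natLeq_on 1 <o natLeq_on 3" "natLeq_on 2 <o natLeq_on 3"
    using natLeq_on_less[of 0 3] natLeq_on_less[of 1 3] natLeq_on_less[of 2 3] by simp_all
  \<comment> \<open>The condition on a conjunct of a \<open>\<Pi>\<^sub>3\<close> formula. A further
    universal quantifier merely lengthens the block, so the axioms can be checked by peeling off
    their leading quantifiers.\<close>
  define allowed where
    "allowed \<psi> \<longleftrightarrow> (\<exists>\<beta> xs \<phi>. \<beta> <o natLeq_on 3 \<and> is_Sigma \<beta> \<phi> \<and> \<psi> = foldr AllF xs \<phi>)" for \<psi>
  have allowed_Sigma: "allowed \<phi>" if "\<beta> <o natLeq_on 3" "is_Sigma \<beta> \<phi>" for \<beta> \<phi>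
    unfolding allowed_def using that by (intro exI[of _ \<beta>] exI[of _ "[]"] exI[of _ \<phi>]) simp
  have allowed_All: "allowed (AllF x \<phi>)" if "allowed \<phi>" for x \<phi>
  proof -
    obtain \<beta> xs \<psi> where "\<beta> <o natLeq_on 3" "is_Sigma \<beta> \<psi>" "\<phi> = foldr AllF xs \<psi>"
      using \<open>allowed \<phi>\<close> unfolding allowed_def by blast
    moreover from this have "AllF x \<phi> = foldr AllF (x # xs) \<psi>" by simp
    ultimately show ?thesis unfolding allowed_def by blast
  qed
  have qf: "allowed \<phi>" if "qf \<phi>" for \<phi>
    using allowed_Sigma[OF lt(1)] is_Sigma_is_Pi.intros(1) that by blast
  have ex: "allowed (ex_qf xs \<phi>)" if "qf \<phi>" for xs \<phi>
    using allowed_Sigma[OF lt(2) is_Sigma_ex_qf[OF that]] .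
  have fin: "allowed finitely_many_below"
    using allowed_Sigma[OF lt(3) is_Sigma_finitely_many_below] .
  have axioms: "\<forall>\<psi>\<in>set middle_axioms. allowed \<psi>"
    unfolding middle_axioms_def by (simp add: allowed_All qf ex fin)
  show ?thesis
    unfolding fin_conj_def
  proof (rule is_Sigma_is_Pi.intros)
    fix \<psi> assume "\<psi> \<in> rcset (acset (set middle_axioms))"
    then have "\<psi> \<in> set middle_axioms" by (simp add: countable_finite)
    then show "\<exists>\<beta> xs \<phi>. \<beta> <o natLeq_on 3 \<and> is_Sigma \<beta> \<phi> \<and> \<psi> = foldr AllF xs \<phi>"
      using axioms unfolding allowed_def by (rule bspec[rotated])
  qed (rule natLeq_on_nonempty, simp)
qed

lemma scott_fm_Sigma_in: "scott_fm \<in> Sigma_in (natLeq_on 4)"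
proof -
  have "is_Sigma (natLeq_on 4) scott_fm"
    unfolding scott_fm_def fin_disj_def
  proof (rule is_Sigma_is_Pi.intros)
    fix \<psi> assume "\<psi> \<in> rcset (acset (set [ExF 0 (fin_conj middle_axioms)]))"
    then have "\<psi> = foldr ExF [0] (fin_conj middle_axioms)" by simp
    moreover have "natLeq_on 3 <o natLeq_on 4" by (rule natLeq_on_less) simp
    ultimately show "\<exists>\<beta> xs \<phi>. \<beta> <o natLeq_on 4 \<and> is_Pi \<beta> \<phi> \<and> \<psi> = foldr ExF xs \<phi>"
      using is_Pi_middle_axioms by blast
  qed (rule natLeq_on_nonempty, simp)
  then show ?thesis using sentence_scott_fm by (simp add: Sigma_in_def sentence_def)
qed

section \<open>Transfer of \<open>\<Pi>\<^sub>4\<close> sentences\<close>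

lemma sat_qf_cong:
  assumes "qf \<phi>" and "\<And>x y. e x = e y \<longleftrightarrow> e' x = e' y"
    and "\<And>x y. (e x, e y) \<in> snd M \<longleftrightarrow> (e' x, e' y) \<in> snd N"
  shows "sat \<phi> M e \<longleftrightarrow> sat \<phi> N e'"
  using assms(1)
proof induction
  case (4 \<Phi>)
  then show ?case by (simp only: sat_ConjF cong: ball_cong)
next
  case (5 \<Phi>)
  then show ?case by (simp only: sat_DisjF cong: bex_cong)
qed (simp_all only: sat.simps assms(2,3))

text \<open>The back-and-forth preorder \<open>(X, u) \<le>\<^sub>n (Y, v)\<close>, formulated through the formulas it preserves.\<close>

definition transfers :: "nat \<Rightarrow> rat set \<Rightarrow> (nat \<Rightarrow> rat) \<Rightarrow> rat set \<Rightarrow> (nat \<Rightarrow> rat) \<Rightarrow> bool" where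
  "transfers n X u Y v \<longleftrightarrow> (\<forall>\<beta> \<phi>. \<beta> \<le>o natLeq_on n \<longrightarrow>
     (is_Pi \<beta> \<phi> \<longrightarrow> sat \<phi> (rat_struct X) (to_nat \<circ> u) \<longrightarrow> sat \<phi> (rat_struct Y) (to_nat \<circ> v)) \<and>
     (is_Sigma \<beta> \<phi> \<longrightarrow> sat \<phi> (rat_struct Y) (to_nat \<circ> v) \<longrightarrow> sat \<phi> (rat_struct X) (to_nat \<circ> u)))"

lemma sat_qf_rat_struct:
  assumes "qf \<phi>" "range u \<subseteq> X" "range v \<subseteq> Y" and le: "\<And>x y. u x \<le> u y \<longleftrightarrow> v x \<le> v y"
  shows "sat \<phi> (rat_struct X) (to_nat \<circ> u) \<longleftrightarrow> sat \<phi> (rat_struct Y) (to_nat \<circ> v)"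
proof (rule sat_qf_cong[OF assms(1)])
  fix x y
  show "(to_nat \<circ> u) x = (to_nat \<circ> u) y \<longleftrightarrow> (to_nat \<circ> v) x = (to_nat \<circ> v) y"
    using le[of x y] le[of y x] by (simp add: order.eq_iff[of "u x"] order.eq_iff[of "v x"])
  have "u x \<in> X" "u y \<in> X" "v x \<in> Y" "v y \<in> Y" using assms(2,3) by auto
  then show "((to_nat \<circ> u) x, (to_nat \<circ> u) y) \<in> snd (rat_struct X) \<longleftrightarrow>
      ((to_nat \<circ> v) x, (to_nat \<circ> v) y) \<in> snd (rat_struct Y)"
    using le by simp
qed

lemma transfers_0:
  assumes "range u \<subseteq> X" "range v \<subseteq> Y" "\<And>x y. u x \<le> u y \<longleftrightarrow> v x \<le> v y"
  shows "transfers 0 X u Y v"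
  unfolding transfers_def
proof (intro allI impI)
  fix \<beta> :: "nat rel" and \<phi> assume "\<beta> \<le>o natLeq_on 0"
  then have \<beta>: "\<beta> = {}" by (rule ordLeq_empty) simp
  have "qf \<phi>" if "is_Pi \<beta> \<phi> \<or> is_Sigma \<beta> \<phi>"
    using that \<beta> by (auto elim: is_Pi.cases is_Sigma.cases)
  then show "(is_Pi \<beta> \<phi> \<longrightarrow> sat \<phi> (rat_struct X) (to_nat \<circ> u) \<longrightarrow> sat \<phi> (rat_struct Y) (to_nat \<circ> v)) \<and>
     (is_Sigma \<beta> \<phi> \<longrightarrow> sat \<phi> (rat_struct Y) (to_nat \<circ> v) \<longrightarrow> sat \<phi> (rat_struct X) (to_nat \<circ> u))"
    using sat_qf_rat_struct[OF _ assms] by blast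
qed

text \<open>One round of the game. A universal block true in X is tested at a challenge v' in Y, and
  an existential block true in Y hands over its witness as the challenge; the reply u' reduces both
  to rank n with the sides exchanged. F is the set of variables of the block. The order condition on
  u and v settles rank 0, which is also at most n + 1.\<close>

lemma transfers_Suc:
  assumes uv: "range u \<subseteq> X" "range v \<subseteq> Y" "\<And>x y. u x \<le> u y \<longleftrightarrow> v x \<le> v y"
    and game: "\<And>F v'. finite F \<Longrightarrow> range v' \<subseteq> Y \<Longrightarrow> (\<And>x. x \<notin> F \<Longrightarrow> v' x = v x) \<Longrightarrow>
      \<exists>u'. range u' \<subseteq> X \<and> (\<forall>x. x \<notin> F \<longrightarrow> u' x = u x) \<and> transfers n Y v' X u'"
  shows "transfers (Suc n) X u Y v"
proof -
  let ?X = "rat_struct X" and ?Y = "rat_struct Y"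
  \<comment> \<open>The valuation w has coded values; it is decoded to a rational valuation,
    answered by \<open>game\<close>, and the reply is coded again.\<close>
  have move: "\<exists>w'\<in>updates ?X xs (to_nat \<circ> u). \<forall>\<gamma> \<chi>. \<gamma> \<le>o natLeq_on n \<longrightarrow>
      (is_Pi \<gamma> \<chi> \<longrightarrow> sat \<chi> ?Y w \<longrightarrow> sat \<chi> ?X w') \<and> (is_Sigma \<gamma> \<chi> \<longrightarrow> sat \<chi> ?X w' \<longrightarrow> sat \<chi> ?Y w)"
    if w: "w \<in> updates ?Y xs (to_nat \<circ> v)" for w xs
  proof -
    have "\<exists>r\<in>Y. w x = to_nat r" for x
    proof (cases "x \<in> set xs")
      case True
      then show ?thesis using w by (auto simp: updates_def)
    next
      case False
      then show ?thesis using w uv(2) by (auto simp: updates_def)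
    qed
    then obtain v' where v': "\<And>x. v' x \<in> Y" "\<And>x. w x = to_nat (v' x)" by metis
    have "v' x = v x" if "x \<notin> set xs" for x
      using w that v'(2)[of x] by (simp add: updates_def)
    moreover have "range v' \<subseteq> Y" using v'(1) by auto
    ultimately obtain u' where u': "range u' \<subseteq> X" "\<forall>x. x \<notin> set xs \<longrightarrow> u' x = u x"
        "transfers n Y v' X u'"
      using game[of "set xs" v'] by auto
    have "to_nat \<circ> u' \<in> updates ?X xs (to_nat \<circ> u)"
      using u'(1,2) by (auto simp: updates_def)
    moreover have "w = to_nat \<circ> v'" using v'(2) by auto
    ultimately show ?thesis using u'(3) unfolding transfers_def by blast
  qed
  have less: "\<gamma> \<le>o natLeq_on n" if "\<gamma> <o \<beta>" "\<beta> \<le>o natLeq_on (Suc n)" for \<gamma> \<beta> :: "nat rel"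
    using ordLess_natLeq_on_Suc ordLess_ordLeq_trans that by blast
  have Pi: "sat \<phi> ?Y (to_nat \<circ> v)"
    if \<beta>: "\<beta> \<le>o natLeq_on (Suc n)" and \<phi>: "is_Pi \<beta> \<phi>" and sat: "sat \<phi> ?X (to_nat \<circ> u)" for \<beta> \<phi>
    using \<phi>
  proof cases
    case 1
    then show ?thesis using sat_qf_rat_struct[OF _ uv] sat by blast
  next
    case (2 \<Psi>)
    show ?thesis unfolding 2 sat_ConjF
    proof
      fix \<psi> assume \<psi>: "\<psi> \<in> rcset \<Psi>"
      then obtain \<gamma> xs \<chi> where \<chi>: "\<gamma> <o \<beta>" "is_Sigma \<gamma> \<chi>" "\<psi> = foldr AllF xs \<chi>" using 2 by metis
      have "sat \<psi> ?X (to_nat \<circ> u)" using sat \<psi> unfolding 2 sat_ConjF by blast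
      then have all: "\<forall>w\<in>updates ?X xs (to_nat \<circ> u). sat \<chi> ?X w"
        unfolding \<chi>(3) sat_foldr_AllF .
      show "sat \<psi> ?Y (to_nat \<circ> v)"
        unfolding \<chi>(3) sat_foldr_AllF
      proof
        fix w assume "w \<in> updates ?Y xs (to_nat \<circ> v)"
        then obtain w' where "w' \<in> updates ?X xs (to_nat \<circ> u)"
            "is_Sigma \<gamma> \<chi> \<longrightarrow> sat \<chi> ?X w' \<longrightarrow> sat \<chi> ?Y w"
          using move less[OF \<chi>(1) \<beta>] by blast
        then show "sat \<chi> ?Y w" using all \<chi>(2) by blast
      qed
    qed
  qed
  have Sigma: "sat \<phi> ?X (to_nat \<circ> u)"
    if \<beta>: "\<beta> \<le>o natLeq_on (Suc n)" and \<phi>: "is_Sigma \<beta> \<phi>" and sat: "sat \<phi> ?Y (to_nat \<circ> v)" for \<beta> \<phi>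
    using \<phi>
  proof cases
    case 1
    then show ?thesis using sat_qf_rat_struct[OF _ uv] sat by blast
  next
    case (2 \<Psi>)
    obtain \<psi> where \<psi>: "\<psi> \<in> rcset \<Psi>" "sat \<psi> ?Y (to_nat \<circ> v)" using sat unfolding 2 sat_DisjF by blast
    then obtain \<gamma> xs \<chi> where \<chi>: "\<gamma> <o \<beta>" "is_Pi \<gamma> \<chi>" "\<psi> = foldr ExF xs \<chi>" using 2 by metis
    then obtain w where "w \<in> updates ?Y xs (to_nat \<circ> v)" "sat \<chi> ?Y w"
      using \<psi>(2) unfolding \<chi>(3) sat_foldr_ExF by blast
    moreover from this obtain w' where "w' \<in> updates ?X xs (to_nat \<circ> u)"
        "is_Pi \<gamma> \<chi> \<longrightarrow> sat \<chi> ?Y w \<longrightarrow> sat \<chi> ?X w'"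
      using move less[OF \<chi>(1) \<beta>] by blast
    ultimately have "sat \<psi> ?X (to_nat \<circ> u)" unfolding \<chi>(3) sat_foldr_ExF using \<chi>(2) by blast
    then show ?thesis using \<psi>(1) unfolding 2 sat_DisjF by blast
  qed
  show ?thesis unfolding transfers_def using Pi Sigma by blast
qed

section \<open>The moves between \<omega> + 1 + \<eta> and \<omega> + \<eta>\<close>

lemma finite_range_modified:
  assumes "finite (range f)" "finite F" "\<And>x. x \<notin> F \<Longrightarrow> g x = f x"
  shows "finite (range g)"
proof (rule finite_subset)
  show "range g \<subseteq> range f \<union> g ` F" using assms(3) by (metis UnCI image_eqI image_subsetI rangeI)
qed (use assms in simp)

lemma dlo_on_pos_rat: "dlo_on {0 :: rat <..} {(x, y). x \<le> y}"
  unfolding dlo_on_def lin_on_def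
proof (intro conjI ballI impI)
  fix x :: rat assume "x \<in> {0<..}"
  then have "x / 2 \<in> {0<..}" "(x / 2, x) \<in> {(x, y). x \<le> y}" "x \<noteq> x / 2" by auto
  then show "\<exists>y\<in>{0<..}. (y, x) \<in> {(x, y). x \<le> y} \<and> x \<noteq> y" by blast
  have "x + 1 \<in> {0<..}" "(x, x + 1) \<in> {(x, y). x \<le> y}" "x \<noteq> x + 1" using \<open>x \<in> {0<..}\<close> by auto
  then show "\<exists>y\<in>{0<..}. (x, y) \<in> {(x, y). x \<le> y} \<and> x \<noteq> y" by blast
  fix y assume "(x, y) \<in> {(x, y). x \<le> y} \<and> x \<noteq> y"
  then have "x < y" by auto
  then obtain z where "x < z" "z < y" using dense by blast
  then show "\<exists>z\<in>{0<..}. (x, z) \<in> {(x, y). x \<le> y} \<and> x \<noteq> z \<and> (z, y) \<in> {(x, y). x \<le> y} \<and> z \<noteq> y"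
    using \<open>x \<in> {0<..}\<close> by (intro bexI[of _ z]) auto
qed (auto intro: gt_ex)

text \<open>Everything is cut at \<open>omega_pt N\<close>. Below the cut the tuples agree and a
  challenge is copied. From the cut upwards it may name points of \<omega>, 0 and points of \<eta>;
  all are answered inside \<eta>, which realises every finite extension of the given order pattern.
  No move is left, so only this pattern counts.\<close>

lemma transfers_1:
  assumes w: "range w \<subseteq> omega_eta_rat" "finite (range w)"
    and v: "range v \<subseteq> omega_one_eta_rat" "finite (range v)"
    and le: "\<And>x y. w x \<le> w y \<longleftrightarrow> v x \<le> v y"
    and neg: "\<And>x. w x < 0 \<Longrightarrow> v x = w x \<and> w x < omega_pt N"
    and pos: "\<And>x. w x > 0 \<Longrightarrow> omega_pt N \<le> v x"
  shows "transfers 1 omega_eta_rat w omega_one_eta_rat v"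
  unfolding One_nat_def
proof (rule transfers_Suc[OF w(1) v(1) le])
  fix F v' assume F: "finite (F :: nat set)" and v': "range v' \<subseteq> omega_one_eta_rat"
    and v'v: "\<And>x. x \<notin> F \<Longrightarrow> v' x = v x"
  let ?r = "{(x, y). x \<le> (y :: rat)}" and ?U = "{omega_pt N..}"
  \<comment> \<open>The position above the cut. The ray \<open>?U\<close> is closed because
    \<open>omega_pt N\<close> itself may be a value of v, put there by the move before.\<close>
  define p where "p = {(v x, w x) | x. w x > 0}"
  have "p \<subseteq> range v \<times> range w" by (auto simp: p_def)
  then have "finite p" using v(2) w(2) by (meson finite_SigmaI finite_subset)
  moreover have "partial_iso ?U ?r {0<..} ?r p"
    by (rule partial_isoI) (use pos le in \<open>auto simp: p_def\<close>)
  moreover have linU: "lin_on ?U ?r" by (auto simp: lin_on_def)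
  moreover have "finite (range v' \<inter> ?U)" using finite_range_modified[OF v(2) F v'v] by blast
  ultimately obtain q where q: "p \<subseteq> q" "partial_iso ?U ?r {0<..} ?r q" "range v' \<inter> ?U \<subseteq> Domain q"
    using partial_iso_extend_finite[OF _ _ _ dlo_on_pos_rat, of ?U ?r p "range v' \<inter> ?U"] by auto
  have linP: "lin_on {0 :: rat<..} ?r" using dlo_on_pos_rat by (simp add: dlo_on_def)
  \<comment> \<open>The graph q is single-valued and extends p, so the chosen partner agrees with w
    off F.\<close>
  define w' where "w' x = (if v' x < omega_pt N then v' x else SOME y. (v' x, y) \<in> q)" for x
  have w'q: "(v' x, w' x) \<in> q" if "\<not> v' x < omega_pt N" for x
  proof -
    have "v' x \<in> Domain q" using q(3) that by auto
    then show ?thesis using that unfolding w'_def by (auto intro: someI)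
  qed
  have w'pos: "w' x > 0" if "\<not> v' x < omega_pt N" for x
    using partial_isoD(2)[OF q(2) w'q[OF that]] by simp
  have w'neg: "w' x = v' x" "w' x < 0" if "v' x < omega_pt N" for x
    using that less_trans[OF that omega_pt_neg] by (simp_all add: w'_def)
  have "range w' \<subseteq> omega_eta_rat"
  proof
    fix y assume "y \<in> range w'"
    then obtain x where x: "y = w' x" by blast
    have "v' x \<in> omega_one_eta_rat" using v' by blast
    then show "y \<in> omega_eta_rat"
      using w'pos[of x] w'neg[of x] unfolding x
      by (cases "v' x < omega_pt N") (auto simp: omega_one_eta_rat_def omega_eta_rat_def)
  qed
  moreover have "w' x = w x" if "x \<notin> F" for x
  proof -
    have "w x \<in> omega_eta_rat" using w(1) by blast
    then consider "w x < 0" | "w x > 0" by (auto simp: omega_eta_rat_def)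
    then show ?thesis
    proof cases
      case 1
      then show ?thesis using neg[OF 1] v'v[OF that] by (simp add: w'_def)
    next
      case 2
      then have "(v' x, w x) \<in> q" using q(1) v'v[OF that] by (auto simp: p_def)
      moreover have "(v' x, w' x) \<in> q" using pos[OF 2] v'v[OF that] by (intro w'q) simp
      ultimately show ?thesis using partial_iso_single_valued[OF q(2) linU linP] by blast
    qed
  qed
  moreover have "transfers 0 omega_one_eta_rat v' omega_eta_rat w'"
  proof (rule transfers_0[OF v'])
    fix x y
    show "v' x \<le> v' y \<longleftrightarrow> w' x \<le> w' y"
    proof (cases "v' x < omega_pt N \<or> v' y < omega_pt N")
      case True
      then show ?thesis
        using w'pos[of x] w'neg[of x] w'pos[of y] w'neg[of y] by force
    next
      case False
      then show ?thesis using partial_isoD(3)[OF q(2) w'q w'q] by simp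
    qed
  qed fact
  ultimately show "\<exists>u'. range u' \<subseteq> omega_eta_rat \<and> (\<forall>x. x \<notin> F \<longrightarrow> u' x = w x) \<and>
      transfers 0 omega_one_eta_rat v' omega_eta_rat u'" by blast
qed

lemma finite_below_omega_pt:
  assumes "finite S" "S \<subseteq> omega_eta_rat"
  shows "\<exists>N. \<forall>s\<in>S. s < 0 \<longrightarrow> s < omega_pt N"
  using assms
proof (induction rule: finite_induct)
  case (insert s S)
  then obtain N where N: "\<forall>s\<in>S. s < 0 \<longrightarrow> s < omega_pt N" by auto
  consider n where "s = omega_pt n" | "s > 0" using insert.prems by (auto simp: omega_eta_rat_def)
  then show ?case
  proof cases
    case (1 n)
    \<comment> \<open>With \<open>Suc n\<close> the bound is strict at s as well, which keeps
      \<open>omega_pt N\<close> free to become the image of another point.\<close>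
    have "t < omega_pt (max N (Suc n))" if "t \<in> S" "t < 0" for t
      using N that by (meson less_le_trans max.cobounded1 omega_pt_le_iff)
    then show ?thesis using 1 by (intro exI[of _ "max N (Suc n)"]) auto
  next
    case 2
    then show ?thesis using N by (intro exI[of _ N]) auto
  qed
qed simp

text \<open>A point \<open>q\<close> just above \<open>\<omega>\<close> in \<open>\<omega> + \<eta>\<close> passes for the middle point of \<open>\<omega> + 1 + \<eta>\<close>: finitely many
  points between \<open>\<omega>\<close> and \<open>q\<close> can be answered by points far out in \<open>\<omega>\<close>.\<close>

lemma transfers_2:
  assumes v: "range v \<subseteq> omega_one_eta_rat" "finite (range v)"
    and q: "q > 0" "\<And>x. v x > 0 \<Longrightarrow> q < v x"
  shows "transfers 2 omega_one_eta_rat v omega_eta_rat (\<lambda>x. if v x = 0 then q else v x)"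
  unfolding numeral_2_eq_2 One_nat_def[symmetric]
proof (rule transfers_Suc[OF v(1)])
  let ?f = "\<lambda>x. if v x = 0 then q else v x"
  show "range ?f \<subseteq> omega_eta_rat"
    using v(1) q(1) by (auto simp: omega_one_eta_rat_def omega_eta_rat_def)
  show "v x \<le> v y \<longleftrightarrow> ?f x \<le> ?f y" for x y
    using q(1) q(2)[of x] q(2)[of y] by (cases "v x > 0"; cases "v y > 0") auto
  fix F w assume F: "finite (F :: nat set)" and w: "range w \<subseteq> omega_eta_rat"
    and wf: "\<And>x. x \<notin> F \<Longrightarrow> w x = ?f x"
  have "finite (range ?f)" by (rule finite_subset[of _ "insert q (range v)"]) (use v(2) in auto)
  then have finw: "finite (range w)" using F wf by (rule finite_range_modified)
  obtain N where N: "\<And>x. w x < 0 \<Longrightarrow> w x < omega_pt N"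
    using finite_below_omega_pt[OF finw w] by auto
  \<comment> \<open>The size of \<open>D z\<close> is the position of z, counted from 0, among the
    positive points of the challenge. The points between 0 and q are thus sent in order to
    \<open>omega_pt N\<close>, \<open>omega_pt (N + 1)\<close> and so on, beyond all its negative
    points, while q returns to 0.\<close>
  define D where "D z = {y\<in>range w. 0 < y \<and> y < z}" for z
  define g where "g z = (if 0 < z \<and> z < q then omega_pt (N + card (D z)) else if z = q then 0 else z)" for z
  have nz: "w x \<noteq> 0" for x
  proof -
    have "w x \<in> omega_eta_rat" using w by blast
    then show ?thesis by (auto simp: omega_eta_rat_def)
  qed
  have g_neg: "g z = z" if "z < 0" for z using that q(1) by (simp add: g_def)
  have g_mid: "g z = omega_pt (N + card (D z))" if "0 < z" "z < q" for z using that by (simp add: g_def)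
  have g_q: "g q = 0" using q(1) by (simp add: g_def)
  have g_gt: "g z = z" if "q < z" for z using that by (simp add: g_def)
  have D_mono: "card (D (w x)) < card (D (w y))" if "0 < w x" "w x < w y" for x y
  proof (rule psubset_card_mono)
    show "finite (D (w y))" using finw by (simp add: D_def)
    have "w x \<in> D (w y)" "w x \<notin> D (w x)" "D (w x) \<subseteq> D (w y)" using that by (auto simp: D_def)
    then show "D (w x) \<subset> D (w y)" by blast
  qed
  have g_ge: "omega_pt N \<le> g z" if "z > 0" for z
    using that order.strict_trans[OF omega_pt_neg[of N], of z] by (auto simp: g_def less_imp_le)
  have mono: "g (w x) < g (w y)" if xy: "w x < w y" for x y
  proof -
    consider "w x < 0" | "0 < w x" "w x < q" | "w x = q" | "q < w x" using nz[of x] by linarith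
    then show ?thesis
    proof cases
      case 1
      then show ?thesis
        using N[OF 1] g_neg g_ge[of "w y"] nz[of y] xy by (cases "w y < 0") auto
    next
      case 2
      consider "w y < q" | "w y = q" | "q < w y" by linarith
      then show ?thesis
      proof cases
        case 1
        then show ?thesis using g_mid[OF 2] g_mid[of "w y"] D_mono[OF 2(1) xy] xy 2 by simp
      next
        case b: 2
        then show ?thesis using g_mid[OF 2] g_q by simp
      next
        case 3
        then show ?thesis using g_mid[OF 2] g_gt[OF 3] q(1) omega_pt_neg[of "N + card (D (w x))"] by linarith
      qed
    next
      case 3
      then show ?thesis using g_q g_gt[of "w y"] xy q(1) by simp
    next
      case 4
      then show ?thesis using g_gt[of "w x"] g_gt[of "w y"] xy by simp
    qed
  qed
  have le: "w x \<le> w y \<longleftrightarrow> g (w x) \<le> g (w y)" for x y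
    by (cases "w x" "w y" rule: linorder_cases) (use mono[of x y] mono[of y x] in auto)
  have gA: "range (\<lambda>x. g (w x)) \<subseteq> omega_one_eta_rat"
  proof
    fix y assume "y \<in> range (\<lambda>x. g (w x))"
    then obtain x where x: "y = g (w x)" by blast
    have "w x \<in> omega_eta_rat" using w by blast
    then show "y \<in> omega_one_eta_rat"
      unfolding x g_def by (auto simp: omega_one_eta_rat_def omega_eta_rat_def)
  qed
  \<comment> \<open>Off F no value of w lies strictly between 0 and q, because q is below every
    positive value of v; hence g just undoes the replacement of 0 by q.\<close>
  have gv: "g (w x) = v x" if "x \<notin> F" for x
    using wf[OF that] g_q g_neg[of "v x"] g_gt[of "v x"] q(2)[of x]
    by (cases "v x" "0 :: rat" rule: linorder_cases) auto
  have fin: "finite (range (\<lambda>x. g (w x)))"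
    using finite_imageI[OF finw, of g] by (simp add: image_image)
  have "transfers 1 omega_eta_rat w omega_one_eta_rat (\<lambda>x. g (w x))"
    by (rule transfers_1[OF w finw gA fin le]) (use g_neg N g_ge in auto)
  then show "\<exists>u'. range u' \<subseteq> omega_one_eta_rat \<and> (\<forall>x. x \<notin> F \<longrightarrow> u' x = v x) \<and>
      transfers 1 omega_eta_rat w omega_one_eta_rat u'"
    using gA gv by blast
qed

text \<open>A challenge v leaves the smaller order only through the value 0, which u never takes.
  Replacing it by a point of \<eta> below every positive value of v gives a reply that, by
  \<open>transfers_2\<close>, holds for two more moves.\<close>

lemma transfers_3:
  assumes u: "range u \<subseteq> omega_eta_rat" "finite (range u)"
  shows "transfers 3 omega_eta_rat u omega_one_eta_rat u"
  unfolding numeral_3_eq_3 numeral_2_eq_2[symmetric]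
proof (rule transfers_Suc[OF u(1)])
  show "range u \<subseteq> omega_one_eta_rat" using u(1) by (auto simp: omega_one_eta_rat_def)
  fix F v assume F: "finite (F :: nat set)" and v: "range v \<subseteq> omega_one_eta_rat"
    and vu: "\<And>x. x \<notin> F \<Longrightarrow> v x = u x"
  have fin: "finite (range v)" using finite_range_modified[OF u(2) F vu] by blast
  \<comment> \<open>The point 1 keeps S nonempty when v has no positive value; half of its least
    element then lies below them all.\<close>
  define S where "S = insert 1 {y\<in>range v. 0 < y}"
  have S: "finite S" "S \<noteq> {}" "\<forall>y\<in>S. 0 < y" using fin by (auto simp: S_def)
  then have pos: "Min S > 0" by simp
  define q where "q = Min S / 2"
  have q: "q > 0" using pos by (simp add: q_def)
  have q': "q < v x" if "v x > 0" for x
  proof -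
    have "Min S \<le> v x" using S(1) that by (intro Min_le) (auto simp: S_def)
    then show ?thesis using pos by (simp add: q_def)
  qed
  let ?f = "\<lambda>x. if v x = 0 then q else v x"
  have "u x \<noteq> 0" for x
  proof -
    have "u x \<in> omega_eta_rat" using u(1) by blast
    then show ?thesis by (auto simp: omega_eta_rat_def)
  qed
  then have "\<forall>x. x \<notin> F \<longrightarrow> ?f x = u x" using vu by auto
  moreover have "range ?f \<subseteq> omega_eta_rat"
    using v q by (auto simp: omega_one_eta_rat_def omega_eta_rat_def)
  moreover have "transfers 2 omega_one_eta_rat v omega_eta_rat ?f"
    by (rule transfers_2[OF v fin q q'])
  ultimately show "\<exists>u'. range u' \<subseteq> omega_eta_rat \<and> (\<forall>x. x \<notin> F \<longrightarrow> u' x = u x) \<and>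
      transfers 2 omega_one_eta_rat v omega_eta_rat u'" by blast
qed simp

text \<open>A challenge in the smaller order is its own reply, since that order is a subset of the
  larger one.\<close>

lemma transfers_4:
  assumes u: "range u \<subseteq> omega_eta_rat" "finite (range u)"
  shows "transfers 4 omega_one_eta_rat u omega_eta_rat u"
proof -
  have sub: "omega_eta_rat \<subseteq> omega_one_eta_rat" by (auto simp: omega_one_eta_rat_def)
  have "transfers (Suc 3) omega_one_eta_rat u omega_eta_rat u"
  proof (rule transfers_Suc)
    show "range u \<subseteq> omega_one_eta_rat" using u(1) sub by blast
    fix F v assume "finite (F :: nat set)" and v: "range v \<subseteq> omega_eta_rat"
      and vu: "\<And>x. x \<notin> F \<Longrightarrow> v x = u x"
    then have "finite (range v)" using finite_range_modified[OF u(2)] by blast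
    then show "\<exists>u'. range u' \<subseteq> omega_one_eta_rat \<and> (\<forall>x. x \<notin> F \<longrightarrow> u' x = u x) \<and>
        transfers 3 omega_eta_rat v omega_one_eta_rat u'"
      using transfers_3[OF v] v vu sub by blast
  qed (use u in auto)
  then show ?thesis by simp
qed

text \<open>A \<open>\<Sigma>\<close> sentence travels against the preorder, so
  \<open>transfers_3\<close>, which runs from \<omega> + \<eta> to \<omega> + 1 + \<eta>, carries it
  in the same direction as \<open>transfers_4\<close> carries a \<open>\<Pi>\<close> sentence. The
  \<open>\<Sigma>\<close> case has to stop below rank 4, where the Scott sentence lives.\<close>

lemma models_omega_eta:
  assumes "models (rat_struct omega_one_eta_rat) \<phi>" "sentence \<phi>" "\<alpha> \<le>o natLeq_on 4"
    and "is_Pi \<alpha> \<phi> \<or> is_Sigma \<alpha> \<phi> \<and> \<alpha> <o natLeq_on 4"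
  shows "models (rat_struct omega_eta_rat) \<phi>"
proof -
  define u :: "nat \<Rightarrow> rat" where "u = (\<lambda>_. 1)"
  have u: "range u \<subseteq> omega_eta_rat" "finite (range u)" by (auto simp: u_def omega_eta_rat_def)
  have uA: "range (to_nat \<circ> u) \<subseteq> fst (rat_struct omega_one_eta_rat)"
    and uB: "range (to_nat \<circ> u) \<subseteq> fst (rat_struct omega_eta_rat)"
    using u(1) by (auto simp: omega_one_eta_rat_def)
  have sat: "sat \<phi> (rat_struct omega_one_eta_rat) (to_nat \<circ> u)"
    using assms(1,2) uA models_sentence_iff by blast
  have "sat \<phi> (rat_struct omega_eta_rat) (to_nat \<circ> u)"
    using assms(4)
  proof
    assume "is_Pi \<alpha> \<phi>"
    then show ?thesis using transfers_4[OF u] assms(3) sat unfolding transfers_def by blast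
  next
    assume a: "is_Sigma \<alpha> \<phi> \<and> \<alpha> <o natLeq_on 4"
    then have "\<alpha> \<le>o natLeq_on 3" using ordLess_natLeq_on_Suc[of \<alpha> 3] by simp
    then show ?thesis using transfers_3[OF u] a sat unfolding transfers_def by blast
  qed
  then show ?thesis using assms(2) uB models_sentence_iff by blast
qed

section \<open>Minimality of \<open>\<Sigma>\<^sub>4\<close> among all complexity classes\<close>

theorem mainTheorem7:
  shows "\<exists>(A :: nat set) (R :: nat rel).
    is_struct (A, R) \<and> linear_order_on A R \<and>
    scott_sentence_complexity (A, R) (Sigma_in (natLeq_on 4))"
proof -
  let ?M = "rat_struct omega_one_eta_rat" and ?N = "rat_struct omega_eta_rat"
  let ?S = "Sigma_in (natLeq_on 4)"
  have struct: "is_struct ?M" "is_struct ?N"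
    by (rule is_struct_rat_struct, auto simp: omega_one_eta_rat_def omega_eta_rat_def)+
  have no: "\<not> models ?N \<phi> \<and> models ?M \<phi> \<and> sentence \<phi>" if "scott_sentence ?M \<phi>" for \<phi>
  proof -
    have "isomorphic ?M ?M" unfolding isomorphic_def by (rule exI[of _ id]) auto
    then show ?thesis
      using that struct not_isomorphic_omega_eta unfolding scott_sentence_def by blast
  qed
  have "class_le ?S \<Delta>" if \<Delta>: "\<Delta> \<in> complexity_classes" "has_scott_sentence_in ?M \<Delta>" for \<Delta>
  proof -
    obtain \<alpha> where \<alpha>: "Well_order \<alpha>" "\<alpha> \<noteq> {}"
        "\<Delta> = Pi_in \<alpha> \<or> \<Delta> = Sigma_in \<alpha> \<or> \<Delta> = dSigma_in \<alpha>"
      using \<Delta>(1) unfolding complexity_classes_def by blast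
    obtain \<phi> where \<phi>: "\<phi> \<in> \<Delta>" "scott_sentence ?M \<phi>" using \<Delta>(2) by (auto simp: has_scott_sentence_in_def)
    note M = no[OF \<phi>(2)]
    have not_Pi: False if "\<Delta> = Pi_in \<alpha>" "\<alpha> \<le>o natLeq_on 4"
      using M \<phi>(1) models_omega_eta[of \<phi> \<alpha>] that by (auto simp: Pi_in_def)
    \<comment> \<open>Below index 4 each kind of class would give a Scott sentence that also holds
      in \<omega> + \<eta>.\<close>
    have ge4: "natLeq_on 4 \<le>o \<alpha>"
    proof (rule ccontr)
      assume "\<not> natLeq_on 4 \<le>o \<alpha>"
      then have lt: "\<alpha> <o natLeq_on 4"
        using ordLess_or_ordLeq[OF \<alpha>(1) natLeq_on_Well_order[of 4]] by blast
      then have le: "\<alpha> \<le>o natLeq_on 4" by (rule ordLess_imp_ordLeq)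
      consider "\<Delta> = Pi_in \<alpha>" | "\<Delta> = Sigma_in \<alpha>" | "\<Delta> = dSigma_in \<alpha>" using \<alpha>(3) by blast
      then show False
      proof cases
        case 1
        then show False using not_Pi le by blast
      next
        case 2
        then show False using M \<phi>(1) models_omega_eta[of \<phi> \<alpha>] lt le by (auto simp: Sigma_in_def)
      next
        case 3
        then obtain \<sigma> \<pi> where d: "\<phi> = ConjF (cinsert \<sigma> (csingle \<pi>))" "is_Sigma \<alpha> \<sigma>" "is_Pi \<alpha> \<pi>"
          using \<phi>(1) by (auto simp: dSigma_in_def Sigma_in_def Pi_in_def)
        have "rcset (cinsert \<sigma> (csingle \<pi>)) = {\<sigma>, \<pi>}"
          by (simp add: cinsert.rep_eq bot_cset.rep_eq)
        \<comment> \<open>Both halves of the conjunction are sentences true in \<open>?M\<close>,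
          and each transfers separately to \<open>?N\<close>.\<close>
        then have m: "models K \<phi> \<longleftrightarrow> models K \<sigma> \<and> models K \<pi>" "fv \<phi> = fv \<sigma> \<union> fv \<pi>" for K
          unfolding d(1) models_def by auto
        then have "sentence \<sigma>" "sentence \<pi>" using M by (auto simp: sentence_def)
        then show False
          using M m(1) models_omega_eta[of \<sigma> \<alpha>] models_omega_eta[of \<pi> \<alpha>] d(2,3) lt le by blast
      qed
    qed
    have Sigma: "\<psi> \<in> Sigma_in \<alpha>" if "\<psi> \<in> ?S" for \<psi>
      using that is_Sigma_mono[OF _ natLeq_on_nonempty ge4] by (simp add: Sigma_in_def)
    consider "\<Delta> = Pi_in \<alpha>" | "\<Delta> = Sigma_in \<alpha>" | "\<Delta> = dSigma_in \<alpha>" using \<alpha>(3) by blast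
    then show ?thesis
    proof cases
      case 1
      \<comment> \<open>Index 4 is already excluded here, so the inequality is strict and a
        \<open>\<Sigma>\<^sub>4\<close> formula can be the only conjunct of a \<open>\<Pi>\<close>
        formula of index \<alpha>, under an empty universal block.\<close>
      then have gt4: "natLeq_on 4 <o \<alpha>"
        using not_Pi ordLess_or_ordLeq[OF natLeq_on_Well_order[of 4] \<alpha>(1)] by blast
      show ?thesis unfolding class_le_def
      proof
        fix \<psi> assume \<psi>: "\<psi> \<in> ?S"
        have "is_Pi \<alpha> (fin_conj [\<psi>])"
          unfolding fin_conj_def
        proof (rule is_Sigma_is_Pi.intros(4)[OF \<alpha>(2)])
          fix \<theta> assume "\<theta> \<in> rcset (acset (set [\<psi>]))"
          then have "\<theta> = foldr AllF [] \<psi>" by simp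
          then show "\<exists>\<beta> xs \<phi>. \<beta> <o \<alpha> \<and> is_Sigma \<beta> \<phi> \<and> \<theta> = foldr AllF xs \<phi>"
            using gt4 \<psi> unfolding Sigma_in_def by blast
        qed
        then have "fin_conj [\<psi>] \<in> \<Delta>" using \<psi> 1 by (simp add: Pi_in_def Sigma_in_def)
        moreover have "equivalent \<psi> (fin_conj [\<psi>])" by (simp add: equivalent_def)
        ultimately show "\<exists>\<chi>\<in>\<Delta>. equivalent \<psi> \<chi>" by blast
      qed
    next
      case 2
      then show ?thesis using Sigma unfolding class_le_def equivalent_def by blast
    next
      case 3
      show ?thesis unfolding class_le_def
      proof
        fix \<psi> assume \<psi>: "\<psi> \<in> ?S"
        \<comment> \<open>The empty conjunction is true and serves as the \<open>\<Pi>\<close>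
          half.\<close>
        have "is_Pi \<alpha> (ConjF cempty)"
          by (rule is_Sigma_is_Pi.intros(4)[OF \<alpha>(2)]) (simp add: bot_cset.rep_eq)
        then have "ConjF cempty \<in> Pi_in \<alpha>" by (simp add: Pi_in_def bot_cset.rep_eq)
        then have "ConjF (cinsert \<psi> (csingle (ConjF cempty))) \<in> \<Delta>"
          using Sigma[OF \<psi>] unfolding 3 dSigma_in_def by blast
        moreover have "equivalent \<psi> (ConjF (cinsert \<psi> (csingle (ConjF cempty))))"
          by (simp add: equivalent_def cinsert.rep_eq bot_cset.rep_eq)
        ultimately show "\<exists>\<chi>\<in>\<Delta>. equivalent \<psi> \<chi>" by blast
      qed
    qed
  qed
  moreover have "?S \<in> complexity_classes"
    unfolding complexity_classes_def
  proof (rule UN_I)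
    show "natLeq_on 4 \<in> {\<alpha>. Well_order \<alpha> \<and> \<alpha> \<noteq> {}}"
      by (intro CollectI conjI natLeq_on_Well_order natLeq_on_nonempty) simp
  qed simp
  moreover have "has_scott_sentence_in ?M ?S"
    using scott_fm_Sigma_in scott_sentence_scott_fm by (auto simp: has_scott_sentence_in_def)
  ultimately have "scott_sentence_complexity ?M ?S" by (simp add: scott_sentence_complexity_def)
  then show ?thesis
    using struct(1) linear_order_on_rat_struct[of omega_one_eta_rat]
    by (intro exI[of _ "fst ?M"] exI[of _ "snd ?M"] conjI) (simp_all only: prod.collapse)
qed

end
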